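(* $E^{ce}_{\mathrm{Cof}}\equiv_cE^{ce}_{\mathrm{set}}\equiv_cE^2_=$, i.e. these three equivalence relations are pairwise computably bireducible.
   Context: $W_e$ is the $e$-th c.e. set and $W_e^{\emptyset''}$ the $e$-th set c.e. in $\emptyset''$; $A^{[n]}=\{x:\langle x,n\rangle\in A\}$ is the $n$-th column of $A\subseteq\omega$ under the standard pairing function. $i\,E^{ce}_{\mathrm{Cof}}\,j\iff$ for every $n$, $W_i^{[n]}$ is cofinite iff $W_j^{[n]}$ is cofinite. $i\,E^{ce}_{\mathrm{set}}\,j\iff\{W_i^{[n]}:n\in\omega\}=\{W_j^{[n]}:n\in\omega\}$. $i\,E^2_=\,j\iff W_i^{\emptyset''}=W_j^{\emptyset''}$. $E\leq_cF$ means there is a total computable $g$ with $x\,E\,y\iff g(x)\,F\,g(y)$ for all $x,y$; $E\equiv_cF$ means $E\leq_cF$ and $F\leq_cE$. *)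

theory Defs
  imports Main "HOL-Library.Nat_Bijection"
begin

datatype recf = Z | S | Proj nat | Comp recf "recf list" | Prim recf recf | Mn recf | Orc

inductive eval :: "nat set \<Rightarrow> recf \<Rightarrow> nat list \<Rightarrow> nat \<Rightarrow> bool" for A where
  eval_Z: "eval A Z xs 0"
| eval_S: "eval A S (x # xs) (Suc x)"
| eval_Proj: "i < length xs \<Longrightarrow> eval A (Proj i) xs (xs ! i)"
| eval_Comp: "list_all2 (\<lambda>g y. eval A g xs y) gs ys \<Longrightarrow> eval A f ys z \<Longrightarrow> eval A (Comp f gs) xs z"
| eval_Prim0: "eval A f xs y \<Longrightarrow> eval A (Prim f g) (0 # xs) y"
| eval_PrimS: "eval A (Prim f g) (n # xs) y \<Longrightarrow> eval A g (y # n # xs) z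
     \<Longrightarrow> eval A (Prim f g) (Suc n # xs) z"
| eval_Mn: "eval A f (n # xs) 0 \<Longrightarrow> (\<forall>m<n. \<exists>k. eval A f (m # xs) (Suc k))
     \<Longrightarrow> eval A (Mn f) xs n"
| eval_Orc: "eval A Orc (x # xs) (if x \<in> A then 1 else 0)"

fun encode :: "recf \<Rightarrow> nat" where
  "encode Z = prod_encode (0, 0)"
| "encode S = prod_encode (1, 0)"
| "encode (Proj i) = prod_encode (2, i)"
| "encode (Comp f gs) = prod_encode (3, prod_encode (encode f, list_encode (map encode gs)))"
| "encode (Prim f g) = prod_encode (4, prod_encode (encode f, encode g))"
| "encode (Mn f) = prod_encode (5, encode f)"
| "encode Orc = prod_encode (6, 0)"

text \<open>The e-th unary partial A-computable function; indices that code no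
  program denote the empty function.\<close>
definition phi :: "nat set \<Rightarrow> nat \<Rightarrow> nat \<Rightarrow> nat \<Rightarrow> bool" where
  "phi A e x y \<longleftrightarrow> (\<exists>p. encode p = e \<and> eval A p [x] y)"

definition W :: "nat set \<Rightarrow> nat \<Rightarrow> nat set" where
  "W A e = {x. \<exists>y. phi A e x y}"

definition jump :: "nat set \<Rightarrow> nat set" where
  "jump A = {e. e \<in> W A e}"

definition zero2 :: "nat set" where
  "zero2 = jump (jump {})"

definition column :: "nat set \<Rightarrow> nat \<Rightarrow> nat set" where
  "column A n = {x. prod_encode (x, n) \<in> A}"

definition cofinite :: "nat set \<Rightarrow> bool" where
  "cofinite X \<longleftrightarrow> finite (UNIV - X)"

definition E_Cof :: "nat \<Rightarrow> nat \<Rightarrow> bool" where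
  "E_Cof i j \<longleftrightarrow> (\<forall>n. cofinite (column (W {} i) n) \<longleftrightarrow> cofinite (column (W {} j) n))"

definition E_set :: "nat \<Rightarrow> nat \<Rightarrow> bool" where
  "E_set i j \<longleftrightarrow> {column (W {} i) n | n. True} = {column (W {} j) n | n. True}"

definition E2_eq :: "nat \<Rightarrow> nat \<Rightarrow> bool" where
  "E2_eq i j \<longleftrightarrow> W zero2 i = W zero2 j"

definition computable_total :: "(nat \<Rightarrow> nat) \<Rightarrow> bool" where
  "computable_total g \<longleftrightarrow> (\<exists>p. \<forall>x. eval {} p [x] (g x))"

definition c_reducible :: "(nat \<Rightarrow> nat \<Rightarrow> bool) \<Rightarrow> (nat \<Rightarrow> nat \<Rightarrow> bool) \<Rightarrow> bool" where
  "c_reducible E F \<longleftrightarrow> (\<exists>g. computable_total g \<and> (\<forall>x y. E x y \<longleftrightarrow> F (g x) (g y)))"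

definition c_bireducible :: "(nat \<Rightarrow> nat \<Rightarrow> bool) \<Rightarrow> (nat \<Rightarrow> nat \<Rightarrow> bool) \<Rightarrow> bool" where
  "c_bireducible E F \<longleftrightarrow> c_reducible E F \<and> c_reducible F E"

end

theory Submission
  imports Defs
begin

text \<open>All three relations compare \<open>\<Sigma>\<^sub>3\<close> sets uniformly coded by their indices. A set is c.e. in
  \<open>\<emptyset>''\<close> iff it has the form \<open>{n. \<exists>k. \<forall>u. \<exists>v. P k u v n}\<close> with \<open>P\<close> decidable, uniformly in the
  indices: a halting computation with an oracle is certified by a finite derivation, and the answers
  of the oracle occurring in it are \<open>\<Sigma>\<^sub>2\<close> or \<open>\<Pi>\<^sub>2\<close> conditions. Both
  \<open>{n. W\<^sub>i\<^bsup>[n]\<^esup> is cofinite}\<close> and \<open>{e. W\<^sub>e is a column of W\<^sub>i}\<close> are of this form.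

  Conversely, write the \<open>\<Sigma>\<^sub>3\<close> condition as ``some \<open>k\<close> fires infinitely often''. The sets
  \<open>{\<langle>n, x\<rangle> | x. x < l}\<close> for all \<open>n\<close>, \<open>l\<close>, together with \<open>{\<langle>n, x\<rangle> | x. some s \<ge> x fires for k}\<close>,
  form a family that determines and is determined by the \<open>\<Sigma>\<^sub>3\<close> set. For cofiniteness, the
  complement of column \<open>n\<close> consists of the pairs of \<open>k\<close> and the last stage at which some \<open>k' \<le> k\<close>
  fires.\<close>

section \<open>Uniqueness of values and composition of programs\<close>

inductive_cases eval_ZE: "eval A Z xs y"
inductive_cases eval_SE: "eval A S xs y"
inductive_cases eval_ProjE: "eval A (Proj i) xs y"
inductive_cases eval_CompE: "eval A (Comp f gs) xs y"
inductive_cases eval_Prim0E: "eval A (Prim f g) (0 # xs) y"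
inductive_cases eval_PrimSE: "eval A (Prim f g) (Suc n # xs) y"
inductive_cases eval_MnE: "eval A (Mn f) xs y"
inductive_cases eval_OrcE: "eval A Orc xs y"

lemma eval_deterministic:
  assumes "eval A p xs y" "eval A p xs z"
  shows "y = z"
  using assms
proof (induction arbitrary: z rule: eval.induct)
  case (eval_Comp xs gs ys f w)
  from eval_Comp.prems obtain ys' where ys': "list_all2 (\<lambda>g y. eval A g xs y) gs ys'" "eval A f ys' z"
    by (rule eval_CompE)
  have "ys = ys'"
  proof (rule nth_equalityI)
    show "length ys = length ys'"
      using list_all2_lengthD [OF eval_Comp.IH(1)] list_all2_lengthD [OF ys'(1)] by simp
    show "ys ! i = ys' ! i" if "i < length ys" for i
      using list_all2_nthD2 [OF eval_Comp.IH(1) that] list_all2_nthD [OF ys'(1), of i] that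
        list_all2_lengthD [OF eval_Comp.IH(1)] by simp
  qed
  with ys'(2) eval_Comp.IH(2) show ?case by blast
next
  case (eval_Prim0 f xs y g)
  from eval_Prim0.prems eval_Prim0.IH show ?case by (blast elim: eval_Prim0E)
next
  case (eval_PrimS f g n xs y w)
  from eval_PrimS.prems obtain y' where "eval A (Prim f g) (n # xs) y'" "eval A g (y' # n # xs) z"
    by (rule eval_PrimSE)
  with eval_PrimS.IH show ?case by blast
next
  case (eval_Mn f n xs)
  from eval_Mn.prems have z: "eval A f (z # xs) 0" "\<forall>m<z. \<exists>k. eval A f (m # xs) (Suc k)"
    by (blast elim: eval_MnE)+
  show ?case
  \<comment> \<open>If the two results differed, \<open>f\<close> would have to be positive at the
    smaller one, where it takes the value 0.\<close>
  proof (rule linorder_cases [of n z])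
    assume "n < z"
    then obtain k where "eval A f (n # xs) (Suc k)" using z by blast
    with eval_Mn.IH(1) have "0 = Suc k" by blast
    then show ?thesis by simp
  next
    assume "z < n"
    then obtain k where "\<forall>w. eval A f (z # xs) w \<longrightarrow> Suc k = w" using eval_Mn.IH(2) by blast
    with z have "Suc k = 0" by blast
    then show ?thesis by simp
  qed
next
  case (eval_Z xs)
  then show ?case by (rule eval_ZE) simp
next
  case (eval_S x xs)
  then show ?case by (rule eval_SE) simp
next
  case (eval_Proj i xs)
  from eval_Proj.prems show ?case by (rule eval_ProjE) simp
next
  case (eval_Orc x xs)
  then show ?case by (rule eval_OrcE) simp_all
qed

lemma eval_Proj_eq: "i < length xs \<Longrightarrow> y = xs ! i \<Longrightarrow> eval A (Proj i) xs y"
  by (simp add: eval_Proj)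

lemma eval_Comp1: "eval A g xs y \<Longrightarrow> eval A f [y] z \<Longrightarrow> eval A (Comp f [g]) xs z"
  by (rule eval_Comp [where ys = "[y]"]) simp_all

lemma eval_Comp2:
  "eval A g xs y \<Longrightarrow> eval A h xs y' \<Longrightarrow> eval A f [y, y'] z \<Longrightarrow> eval A (Comp f [g, h]) xs z"
  by (rule eval_Comp [where ys = "[y, y']"]) simp_all

text \<open>The step program receives the previous value before the counter, whereas
  \<open>rec_nat\<close> hands them to \<open>h\<close> in the opposite order.\<close>

lemma eval_Prim:
  assumes "eval A f xs a" "\<And>i r. eval A g (r # i # xs) (h i r)"
  shows "eval A (Prim f g) (n # xs) (rec_nat a h n)"
  by (induction n) (auto intro: assms eval_Prim0 eval_PrimS)

section \<open>Computable functions and decidable predicates\<close>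

text \<open>The program has to work for all oracles, so that it can be reused at every level of the jump.\<close>

definition computable :: "(nat \<Rightarrow> nat) \<Rightarrow> bool" where
  "computable f \<longleftrightarrow> (\<exists>p. \<forall>A x. eval A p [x] (f x))"

definition computable2 :: "(nat \<Rightarrow> nat \<Rightarrow> nat) \<Rightarrow> bool" where
  "computable2 f \<longleftrightarrow> (\<exists>p. \<forall>A x y. eval A p [x, y] (f x y))"

lemma computable_imp_computable_total: "computable f \<Longrightarrow> computable_total f"
  unfolding computable_def computable_total_def by blast

named_theorems computable_intros

lemma computable_id [computable_intros]: "computable (\<lambda>x. x)"
  unfolding computable_def by (rule exI [of _ "Proj 0"]) (simp add: eval_Proj_eq)

lemma computable_compose: "computable f \<Longrightarrow> computable g \<Longrightarrow> computable (\<lambda>x. f (g x))"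
  unfolding computable_def by (meson eval_Comp1)

lemma computable2_compose:
  "computable2 h \<Longrightarrow> computable f \<Longrightarrow> computable g \<Longrightarrow> computable (\<lambda>x. h (f x) (g x))"
  unfolding computable_def computable2_def by (meson eval_Comp2)

lemma computable2_compose2:
  "computable2 h \<Longrightarrow> computable2 f \<Longrightarrow> computable2 g \<Longrightarrow> computable2 (\<lambda>x y. h (f x y) (g x y))"
  unfolding computable2_def by (meson eval_Comp2)

lemma computable2_compose1: "computable h \<Longrightarrow> computable2 f \<Longrightarrow> computable2 (\<lambda>x y. h (f x y))"
  unfolding computable_def computable2_def by (meson eval_Comp1)

lemma computable_Suc [computable_intros]: "computable f \<Longrightarrow> computable (\<lambda>x. Suc (f x))"
  by (rule computable_compose [of Suc]) (auto simp: computable_def intro: eval_S)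

lemma computable_const [computable_intros]: "computable (\<lambda>x. c)"
proof (induction c)
  case 0
  show ?case unfolding computable_def by (blast intro: eval_Z)
next
  case (Suc c)
  then show ?case by (rule computable_Suc)
qed

lemma computable2_fst: "computable2 (\<lambda>x y. x)"
  unfolding computable2_def by (rule exI [of _ "Proj 0"]) (simp add: eval_Proj_eq)

lemma computable2_snd: "computable2 (\<lambda>x y. y)"
  unfolding computable2_def by (rule exI [of _ "Proj 1"]) (simp add: eval_Proj_eq)

lemma computable2_const: "computable2 (\<lambda>x y. c)"
  by (rule computable2_compose1 [OF computable_const computable2_fst])

text \<open>For now recursion steps have only two arguments. A third would have to be packed by
  pairing, and pairing is built from the arithmetic that these recursions define.\<close>

lemma computable2_rec:
  assumes "computable f" "computable2 g"
  shows "computable2 (\<lambda>x n. rec_nat (f x) (\<lambda>i r. g i r) n)"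
proof -
  obtain p q where p: "\<And>A x. eval A p [x] (f x)" and q: "\<And>A x y. eval A q [x, y] (g x y)"
    using assms unfolding computable_def computable2_def by blast
  have "eval A (Comp (Prim p (Comp q [Proj 1, Proj 0])) [Proj 1, Proj 0]) [x, n]
      (rec_nat (f x) (\<lambda>i r. g i r) n)" for A x n
    by (rule eval_Comp2 eval_Prim p q eval_Proj_eq | simp)+
  then show ?thesis unfolding computable2_def by blast
qed

lemma computable2_rec_param:
  assumes "computable f" "computable2 g"
  shows "computable2 (\<lambda>x n. rec_nat (f x) (\<lambda>i r. g x r) n)"
proof -
  obtain p q where p: "\<And>A x. eval A p [x] (f x)" and q: "\<And>A x y. eval A q [x, y] (g x y)"
    using assms unfolding computable_def computable2_def by blast
  have "eval A (Comp (Prim p (Comp q [Proj 2, Proj 0])) [Proj 1, Proj 0]) [x, n]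
      (rec_nat (f x) (\<lambda>i r. g x r) n)" for A x n
    by (rule eval_Comp2 eval_Prim p q eval_Proj_eq | simp)+
  then show ?thesis unfolding computable2_def by blast
qed

lemma computable_rec_const:
  assumes "computable2 g"
  shows "computable (\<lambda>n. rec_nat c g n)"
  using computable2_compose [OF computable2_rec [OF computable_const assms] computable_id computable_id] .

lemma computable2_add: "computable2 (+)"
proof -
  have "computable2 (\<lambda>x n. rec_nat x (\<lambda>i r. Suc r) n)"
    by (intro computable2_rec computable_intros computable2_compose1 [of Suc] computable2_snd)
  moreover have "rec_nat x (\<lambda>i r. Suc r) n = x + n" for x n :: nat by (induction n) auto
  ultimately show ?thesis by simp
qed

lemmas computable_add [computable_intros] = computable2_compose [OF computable2_add]

lemma computable2_diff: "computable2 (-)"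
proof -
  have "computable (\<lambda>n. rec_nat 0 (\<lambda>i r. i) n)"
    by (intro computable_rec_const computable2_fst)
  moreover have "rec_nat 0 (\<lambda>i r. i) n = n - 1" for n :: nat by (cases n) auto
  ultimately have "computable (\<lambda>n. n - 1)" by simp
  then have "computable2 (\<lambda>x n. rec_nat x (\<lambda>i r. r - 1) n)"
    by (intro computable2_rec computable_intros computable2_compose1 [of "\<lambda>n. n - 1"] computable2_snd)
  moreover have "rec_nat x (\<lambda>i r. r - 1) n = x - n" for x n :: nat by (induction n) auto
  ultimately show ?thesis by simp
qed

lemmas computable_diff [computable_intros] = computable2_compose [OF computable2_diff]

lemma computable2_mult: "computable2 (*)"
proof -
  have "computable2 (\<lambda>x n. rec_nat 0 (\<lambda>i r. x + r) n)"
    by (intro computable2_rec_param computable_intros computable2_add)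
  moreover have "rec_nat 0 (\<lambda>i r. x + r) n = x * n" for x n :: nat by (induction n) auto
  ultimately show ?thesis by simp
qed

lemmas computable_mult [computable_intros] = computable2_compose [OF computable2_mult]

lemma computable_triangle: "computable triangle"
proof -
  have "computable (\<lambda>n. rec_nat 0 (\<lambda>i r. r + Suc i) n)"
    by (intro computable_rec_const computable2_compose2 [OF computable2_add] computable2_snd
        computable2_compose1 [of Suc] computable2_fst computable_intros)
  moreover have "rec_nat 0 (\<lambda>i r. r + Suc i) n = triangle n" for n :: nat by (induction n) auto
  ultimately show ?thesis by (simp add: computable_def)
qed

section \<open>Pairing and its projections\<close>

abbreviation pair_code :: "nat \<Rightarrow> nat \<Rightarrow> nat" (\<open>\<langle>_,/ _\<rangle>\<close>) where
  "\<langle>x, y\<rangle> \<equiv> prod_encode (x, y)"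

definition pfst :: "nat \<Rightarrow> nat" where "pfst z = fst (prod_decode z)"
definition psnd :: "nat \<Rightarrow> nat" where "psnd z = snd (prod_decode z)"

lemma pfst_pair [simp]: "pfst \<langle>x, y\<rangle> = x"
  by (simp add: pfst_def)

lemma psnd_pair [simp]: "psnd \<langle>x, y\<rangle> = y"
  by (simp add: psnd_def)

lemma pair_pfst_psnd [simp]: "\<langle>pfst z, psnd z\<rangle> = z"
  by (simp add: pfst_def psnd_def)

lemma computable2_pair: "computable2 pair_code"
  unfolding prod_encode_def prod.case
  by (intro computable2_compose2 [OF computable2_add] computable2_fst computable2_snd computable2_add
      computable2_compose1 [OF computable_triangle])

lemmas computable_pair [computable_intros] = computable2_compose [OF computable2_pair]

lemma strict_mono_triangle: "strict_mono triangle"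
  by (simp add: strict_mono_Suc_iff)

text \<open>\<open>diagonal z\<close> is the index of the diagonal \<open>m + n = const\<close> on which \<open>z = \<langle>m, n\<rangle>\<close> lies.\<close>

definition diagonal :: "nat \<Rightarrow> nat" where
  "diagonal z = rec_nat 0 (\<lambda>i r. r + (1 - (triangle (Suc r) - Suc i))) z"

text \<open>The summand in the recursion is 1 exactly when \<open>Suc z\<close> has reached the next
  triangular number, and 0 otherwise.\<close>

lemma diagonal_bounds: "triangle (diagonal z) \<le> z \<and> z < triangle (Suc (diagonal z))"
proof (induction z)
  case (Suc z)
  have *: "diagonal (Suc z) =
      (if triangle (Suc (diagonal z)) \<le> Suc z then Suc (diagonal z) else diagonal z)"
    by (auto simp: diagonal_def)
  show ?case using Suc unfolding * by auto
qed (simp add: diagonal_def)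

lemma diagonal_pair: "diagonal \<langle>m, n\<rangle> = m + n"
proof -
  have "triangle (m + n) \<le> \<langle>m, n\<rangle>" "\<langle>m, n\<rangle> < triangle (Suc (m + n))"
    by (simp_all add: prod_encode_def)
  with diagonal_bounds [of "\<langle>m, n\<rangle>"]
  have "triangle (m + n) < triangle (Suc (diagonal \<langle>m, n\<rangle>))"
    "triangle (diagonal \<langle>m, n\<rangle>) < triangle (Suc (m + n))"
    by linarith+
  then show ?thesis
    unfolding strict_mono_less [OF strict_mono_triangle] by simp
qed

lemma computable_diagonal: "computable diagonal"
  unfolding diagonal_def
  by (intro computable_rec_const computable2_compose2 [OF computable2_add]
      computable2_compose2 [OF computable2_diff] computable2_fst computable2_snd
      computable2_compose1 [OF computable_triangle] computable2_compose1 [of Suc]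
      computable2_const computable_intros)

text \<open>A pair code is the triangular number of its diagonal plus the first component.
  Subtracting the former yields \<open>pfst\<close>, and the diagonal index minus
  \<open>pfst\<close> yields \<open>psnd\<close>.\<close>

lemma computable_pfst [computable_intros]: "computable f \<Longrightarrow> computable (\<lambda>x. pfst (f x))"
  and computable_psnd [computable_intros]: "computable f \<Longrightarrow> computable (\<lambda>x. psnd (f x))"
proof -
  have sum: "diagonal z = pfst z + psnd z" for z
    using diagonal_pair [of "pfst z" "psnd z"] by simp
  have "triangle (pfst z + psnd z) + pfst z = \<langle>pfst z, psnd z\<rangle>" for z
    by (simp only: prod_encode_def prod.case)
  then have 1: "pfst z = z - triangle (diagonal z)" for z
    unfolding sum pair_pfst_psnd by (metis add_diff_cancel_left')
  have 2: "psnd z = diagonal z - pfst z" for z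
    by (simp add: sum)
  have 3: "computable pfst" unfolding 1 [abs_def]
    by (intro computable_intros computable_compose [OF computable_triangle] computable_diagonal)
  have 4: "computable psnd" unfolding 2 [abs_def]
    by (intro computable_intros 3 computable_diagonal)
  show "computable f \<Longrightarrow> computable (\<lambda>x. pfst (f x))" "computable f \<Longrightarrow> computable (\<lambda>x. psnd (f x))"
    by (rule computable_compose [OF 3] computable_compose [OF 4]; assumption)+
qed

lemma computable_compose2:
  assumes "computable (\<lambda>z. h (pfst z) (psnd z))" "computable f" "computable g"
  shows "computable (\<lambda>x. h (f x) (g x))"
  using computable_compose [OF assms(1) computable_pair [OF assms(2,3)]] by simp

text \<open>The parameter travels along in the argument list; packing parameter, counter and
  previous value into one number lets a unary program serve as the step.\<close>

lemma computable_rec [computable_intros]: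
  assumes "computable n" "computable f"
    "computable (\<lambda>z. g (pfst z) (pfst (psnd z)) (psnd (psnd z)))"
  shows "computable (\<lambda>x. rec_nat (f x) (g x) (n x))"
proof -
  obtain p q r where p: "\<And>A x. eval A p [x] (f x)"
    and q: "\<And>A z. eval A q [z] (g (pfst z) (pfst (psnd z)) (psnd (psnd z)))"
    and r: "\<And>A x. eval A r [x] (n x)"
    using assms unfolding computable_def by blast
  obtain c where c: "\<And>A x y. eval A c [x, y] \<langle>x, y\<rangle>"
    using computable2_pair unfolding computable2_def by blast
  have step: "eval A (Comp q [Comp c [Proj 2, Comp c [Proj 1, Proj 0]]]) [y, i, x] (g x i y)" for A x i y
  proof (rule eval_Comp1)
    show "eval A (Comp c [Proj 2, Comp c [Proj 1, Proj 0]]) [y, i, x] \<langle>x, \<langle>i, y\<rangle>\<rangle>"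
      by (rule eval_Comp2 c eval_Proj_eq | simp)+
    show "eval A q [\<langle>x, \<langle>i, y\<rangle>\<rangle>] (g x i y)"
      using q [of A "\<langle>x, \<langle>i, y\<rangle>\<rangle>"] by simp
  qed
  have "eval A (Comp (Prim p (Comp q [Comp c [Proj 2, Comp c [Proj 1, Proj 0]]])) [r, Proj 0]) [x]
      (rec_nat (f x) (g x) (n x))" for A x
    by (rule eval_Comp2 eval_Prim p step r eval_Proj_eq | simp)+
  then show ?thesis unfolding computable_def by blast
qed

lemma computable_funpow:
  assumes "computable f" "computable n" "computable a"
  shows "computable (\<lambda>x. (f ^^ n x) (a x))"
proof -
  have "(f ^^ m) b = rec_nat b (\<lambda>_ r. f r) m" for m b by (induction m) auto
  then show ?thesis by (simp only:) (intro computable_intros assms computable_compose [OF assms(1)])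
qed

section \<open>Decidable predicates\<close>

definition decidable :: "(nat \<Rightarrow> bool) \<Rightarrow> bool" where
  "decidable P \<longleftrightarrow> computable (\<lambda>x. of_bool (P x))"

lemma computable_of_bool [computable_intros]: "decidable P \<Longrightarrow> computable (\<lambda>x. of_bool (P x))"
  by (simp add: decidable_def)

lemma decidable_compose: "decidable P \<Longrightarrow> computable f \<Longrightarrow> decidable (\<lambda>x. P (f x))"
  unfolding decidable_def by (rule computable_compose)

lemma decidable_compose2:
  "decidable (\<lambda>z. P (pfst z) (psnd z)) \<Longrightarrow> computable f \<Longrightarrow> computable g \<Longrightarrow> decidable (\<lambda>x. P (f x) (g x))"
  unfolding decidable_def by (rule computable_compose2)

lemma decidable_not [computable_intros]:
  assumes "decidable P"
  shows "decidable (\<lambda>x. \<not> P x)"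
proof -
  have "computable (\<lambda>x. 1 - of_bool (P x))" by (intro computable_intros assms)
  moreover have "(1 - of_bool (P x) :: nat) = of_bool (\<not> P x)" for x by simp
  ultimately show ?thesis by (simp add: decidable_def)
qed

lemma decidable_conj [computable_intros]:
  assumes "decidable P" "decidable Q"
  shows "decidable (\<lambda>x. P x \<and> Q x)"
proof -
  have "computable (\<lambda>x. of_bool (P x) * of_bool (Q x))" by (intro computable_intros assms)
  then show ?thesis by (simp only: decidable_def of_bool_conj)
qed

lemma decidable_disj [computable_intros]:
  assumes "decidable P" "decidable Q"
  shows "decidable (\<lambda>x. P x \<or> Q x)"
  using decidable_not [OF decidable_conj [OF decidable_not decidable_not, OF assms]] by simp

lemma decidable_imp [computable_intros]:
  assumes "decidable P" "decidable Q"
  shows "decidable (\<lambda>x. P x \<longrightarrow> Q x)"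
  using decidable_disj [OF decidable_not [OF assms(1)] assms(2)] by (simp only: imp_conv_disj)

lemma decidable_le [computable_intros]:
  assumes "computable f" "computable g"
  shows "decidable (\<lambda>x. f x \<le> g x)"
proof -
  have "computable (\<lambda>x. 1 - (f x - g x))" by (intro computable_intros assms)
  moreover have "1 - (f x - g x) = of_bool (f x \<le> g x)" for x by auto
  ultimately show ?thesis by (simp add: decidable_def)
qed

lemma decidable_less [computable_intros]:
  assumes "computable f" "computable g"
  shows "decidable (\<lambda>x. f x < g x)"
  using decidable_not [OF decidable_le [OF assms(2,1)]] by (simp add: not_le)

lemma decidable_eq [computable_intros]:
  assumes "computable f" "computable g"
  shows "decidable (\<lambda>x. f x = g x)"
  using decidable_conj [OF decidable_le [OF assms] decidable_le [OF assms(2,1)]]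
  by (simp add: order_eq_iff)

lemma decidable_all_less [computable_intros]:
  assumes "computable b" "decidable (\<lambda>z. P (pfst z) (psnd z))"
  shows "decidable (\<lambda>x. \<forall>y<b x. P x y)"
proof -
  \<comment> \<open>A bounded conjunction is the product of its truth values.\<close>
  have "computable (\<lambda>x. rec_nat 1 (\<lambda>i r. of_bool (P x i) * r) (b x))"
  proof (intro computable_intros assms(1))
    have "decidable (\<lambda>z. P (pfst z) (pfst (psnd z)))"
      by (rule decidable_compose2 [OF assms(2)]) (intro computable_intros)+
    then show "decidable (\<lambda>z. P (pfst z) (pfst (psnd z)))" .
  qed
  moreover have "rec_nat 1 (\<lambda>i r. of_bool (P x i) * r) n = (of_bool (\<forall>y<n. P x y) :: nat)" for x n
    by (induction n) (auto simp: less_Suc_eq)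
  ultimately show ?thesis by (simp add: decidable_def)
qed

lemma decidable_ex_less [computable_intros]:
  assumes "computable b" "decidable (\<lambda>z. P (pfst z) (psnd z))"
  shows "decidable (\<lambda>x. \<exists>y<b x. P x y)"
  using decidable_not [OF decidable_all_less [OF assms(1) decidable_not [OF assms(2)]]] by simp

lemma decidable_all_le [computable_intros]:
  assumes "computable b" "decidable (\<lambda>z. P (pfst z) (psnd z))"
  shows "decidable (\<lambda>x. \<forall>y\<le>b x. P x y)"
  using decidable_all_less [OF computable_Suc [OF assms(1)] assms(2)] by (simp add: less_Suc_eq_le)

lemma decidable_ex_le [computable_intros]:
  assumes "computable b" "decidable (\<lambda>z. P (pfst z) (psnd z))"
  shows "decidable (\<lambda>x. \<exists>y\<le>b x. P x y)"
  using decidable_ex_less [OF computable_Suc [OF assms(1)] assms(2)] by (simp add: less_Suc_eq_le)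

subsection \<open>Coded lists\<close>

text \<open>A nonempty list is coded as the successor of a pair, hence the \<open>c - 1\<close>; 0
  codes the empty list.\<close>

definition lhd :: "nat \<Rightarrow> nat" where "lhd c = pfst (c - 1)"
definition ltl :: "nat \<Rightarrow> nat" where "ltl c = psnd (c - 1)"

lemma lhd_Suc_pair [simp]: "lhd (Suc \<langle>x, c\<rangle>) = x"
  by (simp add: lhd_def)

lemma ltl_Suc_pair [simp]: "ltl (Suc \<langle>x, c\<rangle>) = c"
  by (simp add: ltl_def)

text \<open>Past the end of a list the iterates of \<open>ltl\<close> thus stay at 0, so comparing
  an iterate with 0 tests whether a position exists.\<close>

lemma ltl_0 [simp]: "ltl 0 = 0"
  using psnd_pair [of 0 0] by (simp add: ltl_def prod_encode_def)

lemma computable_lhd [computable_intros]: "computable f \<Longrightarrow> computable (\<lambda>x. lhd (f x))"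
  unfolding lhd_def by (intro computable_intros)

lemma computable_ltl [computable_intros]: "computable f \<Longrightarrow> computable (\<lambda>x. ltl (f x))"
  unfolding ltl_def by (intro computable_intros)

lemma computable_ltl_funpow [computable_intros]:
  "computable n \<Longrightarrow> computable f \<Longrightarrow> computable (\<lambda>x. (ltl ^^ n x) (f x))"
  by (rule computable_funpow [OF computable_ltl [OF computable_id]])

lemma list_decode_nonzero: "c \<noteq> 0 \<Longrightarrow> list_decode c = lhd c # list_decode (ltl c)"
  by (cases c) (simp_all add: lhd_def ltl_def pfst_def psnd_def split: prod.split)

lemma list_decode_eq_Nil_iff [simp]: "list_decode c = [] \<longleftrightarrow> c = 0"
  by (cases "c = 0") (simp_all add: list_decode_nonzero)

lemma list_decode_ltl: "list_decode (ltl c) = tl (list_decode c)"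
  by (cases "c = 0") (simp_all add: list_decode_nonzero)

lemma list_decode_funpow_ltl: "list_decode ((ltl ^^ n) c) = drop n (list_decode c)"
  by (induction n) (simp_all add: list_decode_ltl drop_Suc tl_drop)

lemma funpow_ltl_eq_0_iff [simp]: "(ltl ^^ n) c = 0 \<longleftrightarrow> length (list_decode c) \<le> n"
  using list_decode_eq_Nil_iff [of "(ltl ^^ n) c"] by (simp add: list_decode_funpow_ltl)

lemma lhd_funpow_ltl:
  assumes "n < length (list_decode c)"
  shows "lhd ((ltl ^^ n) c) = list_decode c ! n"
proof -
  have "(ltl ^^ n) c \<noteq> 0" using assms by simp
  from list_decode_nonzero [OF this] have "hd (drop n (list_decode c)) = lhd ((ltl ^^ n) c)"
    by (simp add: list_decode_funpow_ltl)
  with assms show ?thesis by (simp add: hd_drop_conv_nth)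
qed

lemma length_list_decode_le: "length (list_decode c) \<le> c"
proof (induction c rule: less_induct)
  case (less c)
  show ?case
  proof (cases "c = 0")
    case False
    have "ltl c < c"
      using False le_prod_encode_2 [of "psnd (c - 1)" "pfst (c - 1)"] by (simp add: ltl_def)
    with less [of "ltl c"] show ?thesis by (simp add: list_decode_nonzero [OF False])
  qed simp
qed

text \<open>The length of a coded list is at most its code, so quantification over its suffixes is bounded.\<close>

lemma decidable_all_suffix:
  assumes "computable c" "decidable (\<lambda>z. P (pfst z) (psnd z))"
  shows "decidable (\<lambda>x. \<forall>n<length (list_decode (c x)). P x ((ltl ^^ n) (c x)))"
proof -
  have "decidable (\<lambda>x. \<forall>n<c x. (ltl ^^ n) (c x) \<noteq> 0 \<longrightarrow> P x ((ltl ^^ n) (c x)))"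
    by (intro computable_intros assms(1) decidable_compose2 [OF assms(2)] computable_compose [OF assms(1)])
  moreover have "(\<forall>n<c x. (ltl ^^ n) (c x) \<noteq> 0 \<longrightarrow> P x ((ltl ^^ n) (c x))) \<longleftrightarrow>
      (\<forall>n<length (list_decode (c x)). P x ((ltl ^^ n) (c x)))" for x
    using length_list_decode_le [of "c x"] by auto
  ultimately show ?thesis by simp
qed

lemma decidable_ball_list [computable_intros]:
  assumes "computable c" "decidable (\<lambda>z. P (pfst z) (psnd z))"
  shows "decidable (\<lambda>x. \<forall>a\<in>set (list_decode (c x)). P x a)"
proof -
  have "decidable (\<lambda>x. \<forall>n<length (list_decode (c x)). P x (lhd ((ltl ^^ n) (c x))))"
    by (rule decidable_all_suffix [OF assms(1), where P = "\<lambda>x a. P x (lhd a)"])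
      (intro computable_intros decidable_compose2 [OF assms(2)])
  moreover have "(\<forall>n<length (list_decode (c x)). P x (lhd ((ltl ^^ n) (c x)))) \<longleftrightarrow>
      (\<forall>a\<in>set (list_decode (c x)). P x a)" for x
    by (simp add: lhd_funpow_ltl all_set_conv_all_nth)
  ultimately show ?thesis by simp
qed

lemma decidable_bex_list [computable_intros]:
  assumes "computable c" "decidable (\<lambda>z. P (pfst z) (psnd z))"
  shows "decidable (\<lambda>x. \<exists>a\<in>set (list_decode (c x)). P x a)"
  using decidable_not [OF decidable_ball_list [OF assms(1) decidable_not [OF assms(2)]]] by simp

lemma decidable_in_list [computable_intros]:
  assumes "computable f" "computable c"
  shows "decidable (\<lambda>x. f x \<in> set (list_decode (c x)))"
proof -
  have "decidable (\<lambda>x. \<exists>a\<in>set (list_decode (c x)). f x = a)"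
    by (intro computable_intros assms computable_compose [OF assms(1)])
  then show ?thesis by simp
qed

text \<open>Uniqueness of the inner value gives the converse of \<open>eval_Comp1\<close>, so that
  programs with a precomputed argument have exactly the intended domain.\<close>

lemma eval_Comp1_iff:
  assumes "eval A g xs y"
  shows "eval A (Comp f [g]) xs z \<longleftrightarrow> eval A f [y] z"
proof
  assume "eval A (Comp f [g]) xs z"
  then show "eval A f [y] z"
    using eval_deterministic [OF assms] by (auto simp: list_all2_Cons1 elim!: eval_CompE [of A f])
qed (rule eval_Comp1 [OF assms])

section \<open>Enumerability relative to an oracle\<close>

text \<open>These programs build an index into another program. Their codes arise by primitive
  recursion on the constant, which makes the construction computable.\<close>

fun const_prog :: "nat \<Rightarrow> recf" where
  "const_prog 0 = Z"
| "const_prog (Suc n) = Comp S [const_prog n]"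

lemma eval_const_prog: "eval A (const_prog n) xs n"
  by (induction n) (auto intro: eval_Z eval_S eval_Comp1)

lemma computable_encode_const_prog [computable_intros]:
  assumes "computable f"
  shows "computable (\<lambda>x. encode (const_prog (f x)))"
proof -
  have "encode (const_prog n) =
      rec_nat \<langle>0, 0\<rangle> (\<lambda>_ r. \<langle>3, \<langle>\<langle>1, 0\<rangle>, Suc \<langle>r, 0\<rangle>\<rangle>\<rangle>) n" for n
    by (induction n) simp_all
  then show ?thesis by (simp only:) (intro computable_intros assms)
qed

definition ce_in :: "nat set \<Rightarrow> (nat \<Rightarrow> bool) \<Rightarrow> bool" where
  "ce_in A R \<longleftrightarrow> (\<exists>p. \<forall>x. R x \<longleftrightarrow> (\<exists>y. eval A p [x] y))"

text \<open>An index denotes whatever some program with that code computes; injectivity leaves only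
  one such program.\<close>

lemma inj_encode: "encode p = encode q \<Longrightarrow> p = q"
proof (induction p arbitrary: q)
  case (Comp f gs)
  then obtain f' gs' where q: "q = Comp f' gs'"
    by (cases q) (auto simp: prod_encode_eq)
  have f: "f = f'" and m: "map encode gs = map encode gs'"
    using Comp by (auto simp: q prod_encode_eq list_encode_eq)
  have "gs = gs'"
  proof (rule nth_equalityI)
    show "length gs = length gs'" using m by (rule map_eq_imp_length_eq)
    show "gs ! i = gs' ! i" if "i < length gs" for i
      using Comp.IH(2) [of "gs ! i" "gs' ! i"] that m
      by (metis map_eq_imp_length_eq nth_map nth_mem)
  qed
  with f q show ?case by simp
next
  case (Prim f g)
  then show ?case by (cases q) (auto simp: prod_encode_eq)
next
  case (Mn f)
  then show ?case by (cases q) (auto simp: prod_encode_eq)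
qed (case_tac q; simp add: prod_encode_eq)+

lemma mem_W_encode_iff: "x \<in> W A (encode p) \<longleftrightarrow> (\<exists>y. eval A p [x] y)"
  using inj_encode unfolding W_def phi_def by blast

text \<open>This is the s-m-n theorem: \<open>i\<close> is hardwired by \<open>const_prog\<close>,
  and the code of the resulting program is computed without the oracle.\<close>

lemma ce_in_index:
  assumes "ce_in A R"
  shows "\<exists>g. computable g \<and> (\<forall>i. W A (g i) = {x. R \<langle>i, x\<rangle>})"
proof -
  obtain p where p: "\<And>x. R x \<longleftrightarrow> (\<exists>y. eval A p [x] y)"
    using assms unfolding ce_in_def by blast
  obtain c where c: "\<And>A x y. eval A c [x, y] \<langle>x, y\<rangle>"
    using computable2_pair unfolding computable2_def by blast
  define s where "s i = Comp p [Comp c [const_prog i, Proj 0]]" for i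
  have arg: "eval A (Comp c [const_prog i, Proj 0]) [x] \<langle>i, x\<rangle>" for i x
    by (rule eval_Comp2 c eval_Proj_eq eval_const_prog | simp)+
  have "eval A (s i) [x] y \<longleftrightarrow> eval A p [\<langle>i, x\<rangle>] y" for i x y
    unfolding s_def by (rule eval_Comp1_iff [OF arg])
  then have "W A (encode (s i)) = {x. R \<langle>i, x\<rangle>}" for i
    by (auto simp: mem_W_encode_iff p)
  moreover have "computable (\<lambda>i. encode (s i))"
    unfolding s_def encode.simps list.map list_encode.simps by (intro computable_intros)
  ultimately show ?thesis by blast
qed

text \<open>Completeness of the jump: the program with code \<open>h z\<close> ignores its input and
  halts iff \<open>R z\<close>. In particular this decides whether it halts on its own code.\<close>

lemma ce_in_jump:
  assumes "ce_in A R"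
  shows "\<exists>h. computable h \<and> (\<forall>z. h z \<in> jump A \<longleftrightarrow> R z)"
proof -
  obtain p where p: "\<And>x. R x \<longleftrightarrow> (\<exists>y. eval A p [x] y)"
    using assms unfolding ce_in_def by blast
  obtain q where q: "\<And>A z. eval A q [z] (pfst z)"
    using computable_pfst [OF computable_id] unfolding computable_def by blast
  have "eval A (Comp p [q]) [z] y \<longleftrightarrow> eval A p [pfst z] y" for z y
    by (rule eval_Comp1_iff [OF q])
  then have "ce_in A (\<lambda>z. R (pfst z))" unfolding ce_in_def p by blast
  from ce_in_index [OF this] obtain h where "computable h" "\<And>z. W A (h z) = {x. R z}"
    by auto
  then show ?thesis unfolding jump_def by blast
qed

text \<open>The program \<open>p\<close> is only assumed to work for the one oracle
  \<open>A\<close>, because the function searched may itself query \<open>A\<close>.\<close>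

lemma ce_in_search:
  assumes "\<And>z. eval A p [z] (f z)"
  shows "ce_in A (\<lambda>x. \<exists>k. f \<langle>x, k\<rangle> = 0)"
proof -
  obtain c where c: "\<And>A x y. eval A c [x, y] \<langle>x, y\<rangle>"
    using computable2_pair unfolding computable2_def by blast
  define q where "q = Comp p [Comp c [Proj 1, Proj 0]]"
  have q: "eval A q [k, x] (f \<langle>x, k\<rangle>)" for k x
    unfolding q_def by (rule eval_Comp1 [OF _ assms]) (rule eval_Comp2 c eval_Proj_eq | simp)+
  have "(\<exists>k. f \<langle>x, k\<rangle> = 0) \<longleftrightarrow> (\<exists>y. eval A (Mn q) [x] y)" for x
  proof
    assume ex: "\<exists>k. f \<langle>x, k\<rangle> = 0"
    \<comment> \<open>Minimisation demands positive values below its result, so the least zero is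
      needed.\<close>
    define k where "k = (LEAST k. f \<langle>x, k\<rangle> = 0)"
    have "f \<langle>x, k\<rangle> = 0" unfolding k_def using ex by (rule LeastI_ex)
    moreover have "\<exists>l. f \<langle>x, m\<rangle> = Suc l" if "m < k" for m
      using that not_less_Least not0_implies_Suc unfolding k_def by blast
    ultimately have "eval A (Mn q) [x] k"
      by (intro eval_Mn) (metis q)+
    then show "\<exists>y. eval A (Mn q) [x] y" ..
  next
    assume "\<exists>y. eval A (Mn q) [x] y"
    then show "\<exists>k. f \<langle>x, k\<rangle> = 0"
      using eval_deterministic [OF q] by (blast elim: eval_MnE)
  qed
  then show ?thesis unfolding ce_in_def by blast
qed

lemma ce_in_ex_decidable:
  assumes "decidable P"
  shows "ce_in A (\<lambda>x. \<exists>k. P \<langle>x, k\<rangle>)"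
proof -
  obtain p where "\<And>A x. eval A p [x] (of_bool (\<not> P x))"
    using decidable_not [OF assms] unfolding decidable_def computable_def by blast
  from ce_in_search [OF this, of A] show ?thesis by simp
qed

text \<open>A query returns 0 exactly on a negative answer, and zeros are what minimisation searches
  for.\<close>

lemma ce_in_ex_not_oracle:
  assumes "computable h"
  shows "ce_in A (\<lambda>x. \<exists>k. h \<langle>x, k\<rangle> \<notin> A)"
proof -
  obtain p where "\<And>A x. eval A p [x] (h x)"
    using assms unfolding computable_def by blast
  then have "eval A (Comp Orc [p]) [x] (if h x \<in> A then 1 else 0)" for x
    by (blast intro: eval_Comp1 eval_Orc)
  from ce_in_search [OF this] show ?thesis by (simp cong: if_cong split: if_splits)
qed

lemma W_index_ex:
  assumes "decidable P"
  shows "\<exists>g. computable g \<and> (\<forall>i. W A (g i) = {x. \<exists>k. P \<langle>\<langle>i, x\<rangle>, k\<rangle>})"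
  using ce_in_index [OF ce_in_ex_decidable [OF assms]] .

text \<open>Each \<open>ce_in_jump\<close> turns the innermost quantifier into a query to the next jump, and
  negating the answer turns it into the search for a witness of the next quantifier.\<close>

lemma W_zero2_index_ex_all_ex:
  assumes "decidable P"
  shows "\<exists>g. computable g \<and>
    (\<forall>i. W zero2 (g i) = {n. \<exists>k. \<forall>u. \<exists>v. P \<langle>\<langle>\<langle>\<langle>i, n\<rangle>, k\<rangle>, u\<rangle>, v\<rangle>})"
proof -
  obtain h where h: "computable h" "\<And>z. h z \<in> jump {} \<longleftrightarrow> (\<exists>v. P \<langle>z, v\<rangle>)"
    using ce_in_jump [OF ce_in_ex_decidable [OF assms]] by metis
  obtain h' where h': "computable h'" "\<And>z. h' z \<in> zero2 \<longleftrightarrow> (\<exists>u. h \<langle>z, u\<rangle> \<notin> jump {})"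
    using ce_in_jump [OF ce_in_ex_not_oracle [OF h(1)]] unfolding zero2_def by metis
  from ce_in_index [OF ce_in_ex_not_oracle [OF h'(1)], of zero2] show ?thesis
    by (simp add: h h')
qed

section \<open>Certificates\<close>

text \<open>A derivation lists its conclusions in reverse order; \<open>J a R\<close> says that \<open>a\<close> follows in one
  step from premises in \<open>R\<close>.\<close>

fun derivation :: "(nat \<Rightarrow> nat set \<Rightarrow> bool) \<Rightarrow> nat list \<Rightarrow> bool" where
  "derivation J [] \<longleftrightarrow> True"
| "derivation J (a # as) \<longleftrightarrow> J a (set as) \<and> derivation J as"

definition derivable :: "(nat \<Rightarrow> nat set \<Rightarrow> bool) \<Rightarrow> nat \<Rightarrow> bool" where
  "derivable J a \<longleftrightarrow> (\<exists>as. derivation J as \<and> a \<in> set as)"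

lemma derivation_append:
  assumes "\<And>a R R'. J a R \<Longrightarrow> R \<subseteq> R' \<Longrightarrow> J a R'"
    and "derivation J as" "derivation J bs"
  shows "derivation J (as @ bs)"
  using assms(2) by (induction as) (auto intro: assms(1,3))

text \<open>By monotonicity, derivations of finitely many premises can be concatenated into
  one.\<close>

lemma derivable_step:
  assumes mono: "\<And>a R R'. J a R \<Longrightarrow> R \<subseteq> R' \<Longrightarrow> J a R'"
    and "finite F" "\<forall>b\<in>F. derivable J b" "J a F"
  shows "derivable J a"
proof -
  have "\<exists>as. derivation J as \<and> F \<subseteq> set as"
    using assms(2,3)
  proof (induction F)
    case empty
    show ?case by (rule exI [of _ "[]"]) simp
  next
    case (insert b F)
    obtain as where "derivation J as" "F \<subseteq> set as" using insert by auto
    moreover obtain bs where "derivation J bs" "b \<in> set bs"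
      using insert.prems unfolding derivable_def by blast
    ultimately show ?case
      by (intro exI [of _ "as @ bs"]) (auto intro: derivation_append mono)
  qed
  then obtain as where as: "derivation J as" "F \<subseteq> set as" by blast
  with assms(4) mono have "derivation J (a # as)" by auto
  then show ?thesis unfolding derivable_def by fastforce
qed

lemma derivation_induct:
  assumes "derivation J as" "a \<in> set as"
    and "\<And>b R. J b R \<Longrightarrow> (\<And>c. c \<in> R \<Longrightarrow> P c) \<Longrightarrow> P b"
  shows "P a"
proof -
  have "\<forall>b\<in>set as. P b"
    using assms(1) by (induction as) (auto intro: assms(3))
  with assms(2) show ?thesis by blast
qed

lemma derivation_iff_nth:
  "derivation J as \<longleftrightarrow> (\<forall>n<length as. J (as ! n) (set (drop (Suc n) as)))"
  by (induction as) (auto simp: less_Suc_eq_0_disj)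

lemma decidable_derivation:
  assumes "decidable (\<lambda>z. J (pfst z) (set (list_decode (psnd z))))" "computable c"
  shows "decidable (\<lambda>x. derivation J (list_decode (c x)))"
proof -
  have "decidable (\<lambda>x. \<forall>n<length (list_decode (c x)). J (lhd ((ltl ^^ n) (c x))) (set (list_decode (ltl ((ltl ^^ n) (c x))))))"
    by (rule decidable_all_suffix [OF assms(2), where P = "\<lambda>x a. J (lhd a) (set (list_decode (ltl a)))"])
      (intro computable_intros decidable_compose2 [where P = "\<lambda>a b. J a (set (list_decode b))", OF assms(1)])
  moreover have "(\<forall>n<length (list_decode (c x)). J (lhd ((ltl ^^ n) (c x))) (set (list_decode (ltl ((ltl ^^ n) (c x)))))) \<longleftrightarrow>
      derivation J (list_decode (c x))" for x
    unfolding derivation_iff_nth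
    by (simp add: lhd_funpow_ltl list_decode_ltl list_decode_funpow_ltl drop_Suc tl_drop)
  ultimately show ?thesis by simp
qed

subsection \<open>Program codes\<close>

text \<open>\<open>\<langle>0, e\<rangle>\<close> stands for ``\<open>e\<close> codes a program'', and \<open>\<langle>1, l\<rangle>\<close> for ``\<open>l\<close> codes a list of programs''.\<close>

definition prog_rule :: "nat \<Rightarrow> nat set \<Rightarrow> bool" where
  "prog_rule a R \<longleftrightarrow>
    pfst a = 0 \<and>
      (psnd a = \<langle>0, 0\<rangle> \<or> psnd a = \<langle>1, 0\<rangle> \<or> psnd a = \<langle>6, 0\<rangle> \<or> pfst (psnd a) = 2 \<or>
       pfst (psnd a) = 3 \<and> \<langle>0, pfst (psnd (psnd a))\<rangle> \<in> R \<and> \<langle>1, psnd (psnd (psnd a))\<rangle> \<in> R \<or>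
       pfst (psnd a) = 4 \<and> \<langle>0, pfst (psnd (psnd a))\<rangle> \<in> R \<and> \<langle>0, psnd (psnd (psnd a))\<rangle> \<in> R \<or>
       pfst (psnd a) = 5 \<and> \<langle>0, psnd (psnd a)\<rangle> \<in> R) \<or>
    pfst a = 1 \<and>
      (psnd a = 0 \<or> psnd a \<noteq> 0 \<and> \<langle>0, lhd (psnd a)\<rangle> \<in> R \<and> \<langle>1, ltl (psnd a)\<rangle> \<in> R)"

lemma prog_rule_mono: "prog_rule a R \<Longrightarrow> R \<subseteq> R' \<Longrightarrow> prog_rule a R'"
  unfolding prog_rule_def by blast

lemma decidable_prog_rule: "decidable (\<lambda>z. prog_rule (pfst z) (set (list_decode (psnd z))))"
  unfolding prog_rule_def by (intro computable_intros)

lemma derivable_prog_rule: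
  assumes "finite F" "\<forall>b\<in>F. derivable prog_rule b" "prog_rule a F"
  shows "derivable prog_rule a"
  by (rule derivable_step [OF _ assms]) (rule prog_rule_mono)

text \<open>Together with \<open>prog_rule_sound\<close>, this makes derivations decidable
  certificates that a number is a program code, as membership in \<open>W\<close> requires of the
  index.\<close>

lemma derivable_prog: "derivable prog_rule \<langle>0, encode p\<rangle>"
proof (induction p)
  case (Comp f gs)
  have "(\<And>g. g \<in> set gs \<Longrightarrow> derivable prog_rule \<langle>0, encode g\<rangle>) \<Longrightarrow>
      derivable prog_rule \<langle>1, list_encode (map encode gs)\<rangle>" for gs
  proof (induction gs)
    case Nil
    show ?case
      by (rule derivable_prog_rule [of "{}"]) (simp, fastforce, auto simp: prog_rule_def)
  next
    case (Cons g gs)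
    then show ?case
      by (intro derivable_prog_rule [of "{\<langle>0, encode g\<rangle>, \<langle>1, list_encode (map encode gs)\<rangle>}"])
        (simp, fastforce, auto simp: prog_rule_def)
  qed
  with Comp show ?case
    by (intro derivable_prog_rule [of "{\<langle>0, encode f\<rangle>, \<langle>1, list_encode (map encode gs)\<rangle>}"])
      (simp, fastforce, auto simp: prog_rule_def)
next
  case (Prim f g)
  then show ?case
    by (intro derivable_prog_rule [of "{\<langle>0, encode f\<rangle>, \<langle>0, encode g\<rangle>}"])
      (simp, fastforce, auto simp: prog_rule_def)
next
  case (Mn f)
  then show ?case
    by (intro derivable_prog_rule [of "{\<langle>0, encode f\<rangle>}"])
      (simp, fastforce, auto simp: prog_rule_def)
qed (rule derivable_prog_rule [of "{}"], simp, simp, simp add: prog_rule_def)+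

lemma Suc_pair_lhd_ltl: "c \<noteq> 0 \<Longrightarrow> Suc \<langle>lhd c, ltl c\<rangle> = c"
  by (simp add: lhd_def ltl_def)

lemma prog_rule_sound:
  assumes "derivation prog_rule as" "a \<in> set as"
  shows "(pfst a = 0 \<longrightarrow> (\<exists>p. encode p = psnd a)) \<and>
    (pfst a = 1 \<longrightarrow> (\<exists>ps. list_encode (map encode ps) = psnd a))"
  using assms
proof (rule derivation_induct)
  fix b R
  assume J: "prog_rule b R"
    and IH: "\<And>c. c \<in> R \<Longrightarrow> (pfst c = 0 \<longrightarrow> (\<exists>p. encode p = psnd c)) \<and>
      (pfst c = 1 \<longrightarrow> (\<exists>ps. list_encode (map encode ps) = psnd c))"
  have prog: "\<exists>p. encode p = e" if "\<langle>0, e\<rangle> \<in> R" for e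
    using IH [OF that] by simp
  have list: "\<exists>ps. list_encode (map encode ps) = l" if "\<langle>1, l\<rangle> \<in> R" for l
    using IH [OF that] by simp
  show "(pfst b = 0 \<longrightarrow> (\<exists>p. encode p = psnd b)) \<and>
    (pfst b = 1 \<longrightarrow> (\<exists>ps. list_encode (map encode ps) = psnd b))"
  proof (intro conjI impI)
    assume "pfst b = 0"
    with J consider "psnd b = \<langle>0, 0\<rangle>" | "psnd b = \<langle>1, 0\<rangle>" | "psnd b = \<langle>6, 0\<rangle>" | "pfst (psnd b) = 2"
      | "pfst (psnd b) = 3" "\<langle>0, pfst (psnd (psnd b))\<rangle> \<in> R" "\<langle>1, psnd (psnd (psnd b))\<rangle> \<in> R"
      | "pfst (psnd b) = 4" "\<langle>0, pfst (psnd (psnd b))\<rangle> \<in> R" "\<langle>0, psnd (psnd (psnd b))\<rangle> \<in> R"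
      | "pfst (psnd b) = 5" "\<langle>0, psnd (psnd b)\<rangle> \<in> R"
      unfolding prog_rule_def by fastforce
    then show "\<exists>p. encode p = psnd b"
    proof cases
      case 1 then show ?thesis by (intro exI [of _ Z]) simp
    next
      case 2 then show ?thesis by (intro exI [of _ S]) simp
    next
      case 3 then show ?thesis by (intro exI [of _ Orc]) simp
    next
      case 4 then show ?thesis by (intro exI [of _ "Proj (psnd (psnd b))"]) (simp flip: 4)
    next
      case 5
      obtain f gs where "encode f = pfst (psnd (psnd b))" "list_encode (map encode gs) = psnd (psnd (psnd b))"
        using prog [OF 5(2)] list [OF 5(3)] by blast
      with 5(1) have "encode (Comp f gs) = psnd b" by (simp flip: 5(1))
      then show ?thesis ..
    next
      case 6
      obtain f g where "encode f = pfst (psnd (psnd b))" "encode g = psnd (psnd (psnd b))"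
        using prog [OF 6(2)] prog [OF 6(3)] by blast
      with 6(1) have "encode (Prim f g) = psnd b" by (simp flip: 6(1))
      then show ?thesis ..
    next
      case 7
      obtain f where "encode f = psnd (psnd b)"
        using prog [OF 7(2)] by blast
      with 7(1) have "encode (Mn f) = psnd b" by (simp flip: 7(1))
      then show ?thesis ..
    qed
  next
    assume "pfst b = 1"
    with J consider "psnd b = 0" | "psnd b \<noteq> 0" "\<langle>0, lhd (psnd b)\<rangle> \<in> R" "\<langle>1, ltl (psnd b)\<rangle> \<in> R"
      unfolding prog_rule_def by fastforce
    then show "\<exists>ps. list_encode (map encode ps) = psnd b"
    proof cases
      case 1 then show ?thesis by (intro exI [of _ "[]"]) simp
    next
      case 2
      obtain p ps where "encode p = lhd (psnd b)" "list_encode (map encode ps) = ltl (psnd b)"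
        using prog [OF 2(2)] list [OF 2(3)] by blast
      with 2(1) have "list_encode (map encode (p # ps)) = psnd b" by (simp add: Suc_pair_lhd_ltl)
      then show ?thesis ..
    qed
  qed
qed

subsection \<open>Computations\<close>

text \<open>\<open>\<langle>e, \<langle>l, y\<rangle>\<rangle>\<close> stands for ``the program coded by \<open>e\<close> maps the argument list coded by \<open>l\<close> to
  \<open>y\<close>''. The tag \<open>7\<close>, which \<^const>\<open>encode\<close> does not use, marks a code \<open>e\<close> of a list of programs;
  \<open>y\<close> then codes the list of their values. Answers of the oracle are arbitrary here and are
  checked separately.\<close>

definition eval_rule :: "nat \<Rightarrow> nat set \<Rightarrow> bool" where
  "eval_rule a R \<longleftrightarrow>
    (let e = pfst a; t = pfst e; b = psnd e; l = pfst (psnd a); y = psnd (psnd a) in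
      t = 0 \<and> y = 0 \<or>
      t = 1 \<and> l \<noteq> 0 \<and> y = Suc (lhd l) \<or>
      t = 2 \<and> (ltl ^^ b) l \<noteq> 0 \<and> y = lhd ((ltl ^^ b) l) \<or>
      t = 3 \<and> (\<exists>c\<in>R. pfst c = \<langle>7, psnd b\<rangle> \<and> pfst (psnd c) = l \<and>
        \<langle>pfst b, \<langle>psnd (psnd c), y\<rangle>\<rangle> \<in> R) \<or>
      t = 4 \<and> l \<noteq> 0 \<and> lhd l = 0 \<and> \<langle>pfst b, \<langle>ltl l, y\<rangle>\<rangle> \<in> R \<or>
      t = 4 \<and> l \<noteq> 0 \<and> lhd l \<noteq> 0 \<and> (\<exists>c\<in>R. pfst c = e \<and> pfst (psnd c) = Suc \<langle>lhd l - 1, ltl l\<rangle> \<and>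
        \<langle>psnd b, \<langle>Suc \<langle>psnd (psnd c), Suc \<langle>lhd l - 1, ltl l\<rangle>\<rangle>, y\<rangle>\<rangle> \<in> R) \<or>
      t = 5 \<and> \<langle>b, \<langle>Suc \<langle>y, l\<rangle>, 0\<rangle>\<rangle> \<in> R \<and>
        (\<forall>m<y. \<exists>c\<in>R. pfst c = b \<and> pfst (psnd c) = Suc \<langle>m, l\<rangle> \<and> psnd (psnd c) \<noteq> 0) \<or>
      t = 6 \<and> l \<noteq> 0 \<and> y \<le> 1 \<or>
      t = 7 \<and> b = 0 \<and> y = 0 \<or>
      t = 7 \<and> b \<noteq> 0 \<and> y \<noteq> 0 \<and> \<langle>lhd b, \<langle>l, lhd y\<rangle>\<rangle> \<in> R \<and> \<langle>\<langle>7, ltl b\<rangle>, \<langle>l, ltl y\<rangle>\<rangle> \<in> R)"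

text \<open>6 is the tag of \<open>Orc\<close>, and \<open>Orc\<close> is the only program whose
  code has it.\<close>

definition is_query :: "nat \<Rightarrow> bool" where
  "is_query a \<longleftrightarrow> pfst (pfst a) = 6"

definition query :: "nat \<Rightarrow> nat" where
  "query a = lhd (pfst (psnd a))"

definition answer :: "nat \<Rightarrow> nat" where
  "answer a = psnd (psnd a)"

text \<open>Since \<open>eval_rule\<close> allows only the answers 0 and 1, the equivalence
  determines the answer.\<close>

definition oracle_rule :: "nat set \<Rightarrow> nat \<Rightarrow> nat set \<Rightarrow> bool" where
  "oracle_rule A a R \<longleftrightarrow> eval_rule a R \<and> (is_query a \<longrightarrow> (answer a = 1 \<longleftrightarrow> query a \<in> A))"

text \<open>The set of premises occurs only positively in the rule.\<close>

lemma eval_rule_mono: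
  assumes "eval_rule a R" "R \<subseteq> R'"
  shows "eval_rule a R'"
proof -
  have bex: "(\<exists>c\<in>R. P c) \<Longrightarrow> (\<And>c. P c \<Longrightarrow> Q c) \<Longrightarrow> \<exists>c\<in>R'. Q c" for P Q
    using assms(2) by blast
  have "eval_rule a R \<longrightarrow> eval_rule a R'"
    unfolding eval_rule_def Let_def
    by (rule impI, elim disj_forward conj_forward all_forward imp_forward bex; (assumption | erule subsetD [OF assms(2)]))
  with assms(1) show ?thesis by blast
qed

lemma oracle_rule_mono: "oracle_rule A a R \<Longrightarrow> R \<subseteq> R' \<Longrightarrow> oracle_rule A a R'"
  unfolding oracle_rule_def using eval_rule_mono by blast

text \<open>This separates the decidable shape of a computation from finitely many conditions on the
  oracle.\<close>

lemma derivation_oracle_rule_iff: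
  "derivation (oracle_rule A) as \<longleftrightarrow>
    derivation eval_rule as \<and> (\<forall>a\<in>set as. is_query a \<longrightarrow> (answer a = 1 \<longleftrightarrow> query a \<in> A))"
  by (induction as) (auto simp: oracle_rule_def)

lemma decidable_eval_rule: "decidable (\<lambda>z. eval_rule (pfst z) (set (list_decode (psnd z))))"
  unfolding eval_rule_def Let_def by (intro computable_intros)

abbreviation eval_fact :: "recf \<Rightarrow> nat list \<Rightarrow> nat \<Rightarrow> nat" where
  "eval_fact p xs y \<equiv> \<langle>encode p, \<langle>list_encode xs, y\<rangle>\<rangle>"

lemma derivable_oracle_rule:
  assumes "finite F" "\<forall>b\<in>F. derivable (oracle_rule A) b" "oracle_rule A a F"
  shows "derivable (oracle_rule A) a"
  by (rule derivable_step [OF _ assms]) (rule oracle_rule_mono)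

lemma derivable_eval_fact:
  assumes "eval A p xs y"
  shows "derivable (oracle_rule A) (eval_fact p xs y)"
  using assms
proof (induction rule: eval.induct)
  case (eval_Z xs)
  show ?case
    by (rule derivable_oracle_rule [of "{}"]) (simp, fastforce, auto simp: oracle_rule_def eval_rule_def is_query_def)
next
  case (eval_S x xs)
  show ?case
    by (rule derivable_oracle_rule [of "{}"]) (simp, fastforce, auto simp: oracle_rule_def eval_rule_def is_query_def)
next
  case (eval_Proj i xs)
  then have "(ltl ^^ i) (list_encode xs) \<noteq> 0" "lhd ((ltl ^^ i) (list_encode xs)) = xs ! i"
    by (simp_all add: lhd_funpow_ltl)
  then show ?case
    by (intro derivable_oracle_rule [of "{}"])
      (simp, fastforce, auto simp del: funpow_ltl_eq_0_iff simp: oracle_rule_def eval_rule_def is_query_def)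
next
  case (eval_Comp xs gs ys f z)
  have "list_all2 (\<lambda>g y. derivable (oracle_rule A) (eval_fact g xs y)) gs ys"
    using eval_Comp.IH(1) by (rule list_all2_mono) simp
  \<comment> \<open>The argument values are gathered into a single fact with tag 7, built up along
    the list of programs.\<close>
  then have "derivable (oracle_rule A) \<langle>\<langle>7, list_encode (map encode gs)\<rangle>, \<langle>list_encode xs, list_encode ys\<rangle>\<rangle>"
  proof (induction rule: list_all2_induct)
    case Nil
    show ?case
      by (rule derivable_oracle_rule [of "{}"]) (simp, fastforce, auto simp: oracle_rule_def eval_rule_def is_query_def)
  next
    case (Cons g gs y ys)
    then show ?case
      by (intro derivable_oracle_rule [of "{eval_fact g xs y,
            \<langle>\<langle>7, list_encode (map encode gs)\<rangle>, \<langle>list_encode xs, list_encode ys\<rangle>\<rangle>}"])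
        (simp, fastforce, auto simp: oracle_rule_def eval_rule_def is_query_def)
  qed
  with eval_Comp.IH(2) show ?case
    by (intro derivable_oracle_rule [of "{eval_fact f ys z,
          \<langle>\<langle>7, list_encode (map encode gs)\<rangle>, \<langle>list_encode xs, list_encode ys\<rangle>\<rangle>}"])
      (simp, fastforce, auto simp: oracle_rule_def eval_rule_def is_query_def)
next
  case (eval_Prim0 f xs y g)
  then show ?case
    by (intro derivable_oracle_rule [of "{eval_fact f xs y}"])
      (simp, fastforce, auto simp: oracle_rule_def eval_rule_def is_query_def)
next
  case (eval_PrimS f g n xs y z)
  then show ?case
    by (intro derivable_oracle_rule [of "{eval_fact (Prim f g) (n # xs) y, eval_fact g (y # n # xs) z}"])
      (simp, fastforce, auto simp: oracle_rule_def eval_rule_def is_query_def)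
next
  case (eval_Mn f n xs)
  then obtain k where k: "\<And>m. m < n \<Longrightarrow> derivable (oracle_rule A) (eval_fact f (m # xs) (Suc (k m)))"
    by metis
  \<comment> \<open>The premises are the zero at \<open>n\<close> and one chosen positive value for
    each smaller argument, so they are finite in number.\<close>
  show ?case
    using k eval_Mn.IH(1)
    by (intro derivable_oracle_rule [of "insert (eval_fact f (n # xs) 0)
          ((\<lambda>m. eval_fact f (m # xs) (Suc (k m))) ` {..<n})"])
      (simp, fastforce, auto simp: oracle_rule_def eval_rule_def is_query_def)
next
  case (eval_Orc x xs)
  show ?case
    by (rule derivable_oracle_rule [of "{}"])
      (simp, fastforce, auto simp: oracle_rule_def eval_rule_def is_query_def answer_def query_def)
qed

text \<open>Soundness is conditional on \<open>e\<close> coding a program, because the derivation of a computation of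
  \<^const>\<open>Prim\<close> with first argument \<open>0\<close> does not inspect the step program.\<close>

lemma oracle_rule_sound:
  assumes "derivation (oracle_rule A) as" "a \<in> set as"
  shows "(\<forall>p. encode p = pfst a \<longrightarrow> eval A p (list_decode (pfst (psnd a))) (psnd (psnd a))) \<and>
    (\<forall>ps. \<langle>7, list_encode (map encode ps)\<rangle> = pfst a \<longrightarrow>
      list_all2 (\<lambda>p y. eval A p (list_decode (pfst (psnd a))) y) ps (list_decode (psnd (psnd a))))"
  using assms
proof (rule derivation_induct)
  fix a R
  assume J: "oracle_rule A a R"
    and IH: "\<And>c. c \<in> R \<Longrightarrow>
      (\<forall>p. encode p = pfst c \<longrightarrow> eval A p (list_decode (pfst (psnd c))) (psnd (psnd c))) \<and>
      (\<forall>ps. \<langle>7, list_encode (map encode ps)\<rangle> = pfst c \<longrightarrow>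
        list_all2 (\<lambda>p y. eval A p (list_decode (pfst (psnd c))) y) ps (list_decode (psnd (psnd c))))"
  define l y where "l = pfst (psnd a)" and "y = psnd (psnd a)"
  have prog: "eval A p (list_decode l') y'" if "\<langle>encode p, \<langle>l', y'\<rangle>\<rangle> \<in> R" for p l' y'
    using IH [OF that] by simp
  have list: "list_all2 (\<lambda>p y. eval A p (list_decode l') y) ps (list_decode y')"
    if "\<langle>\<langle>7, list_encode (map encode ps)\<rangle>, \<langle>l', y'\<rangle>\<rangle> \<in> R" for ps l' y'
    using IH [OF that] by simp
  have fact_eq: "c = \<langle>pfst c, \<langle>pfst (psnd c), psnd (psnd c)\<rangle>\<rangle>" for c by simp
  have "eval A p (list_decode l) y" if p: "encode p = pfst a" for p
  proof (cases p)
    case Z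
    then have "y = 0"
      using J p [symmetric] by (auto simp: oracle_rule_def eval_rule_def Let_def y_def)
    with Z show ?thesis by (simp add: eval_Z)
  next
    case S
    then have "l \<noteq> 0" "y = Suc (lhd l)"
      using J p [symmetric] by (auto simp: oracle_rule_def eval_rule_def Let_def l_def y_def)
    with S show ?thesis by (simp add: list_decode_nonzero eval_S)
  next
    case (Proj i)
    then have "(ltl ^^ i) l \<noteq> 0" "y = lhd ((ltl ^^ i) l)"
      using J p [symmetric]
      by (auto simp del: funpow_ltl_eq_0_iff simp: oracle_rule_def eval_rule_def Let_def l_def y_def)
    with Proj show ?thesis by (simp add: lhd_funpow_ltl eval_Proj)
  next
    case (Comp f gs)
    then obtain c where c: "c \<in> R" "pfst c = \<langle>7, list_encode (map encode gs)\<rangle>" "pfst (psnd c) = l"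
      "\<langle>encode f, \<langle>psnd (psnd c), y\<rangle>\<rangle> \<in> R"
      using J p [symmetric] by (auto simp: oracle_rule_def eval_rule_def Let_def l_def y_def)
    have "\<langle>\<langle>7, list_encode (map encode gs)\<rangle>, \<langle>l, psnd (psnd c)\<rangle>\<rangle> \<in> R"
      using c(1) fact_eq [of c] unfolding c(2,3) by simp
    from eval_Comp [OF list [OF this] prog [OF c(4)]] Comp show ?thesis by simp
  next
    case (Prim f g)
    have l0: "l \<noteq> 0"
      using J p [symmetric] Prim by (auto simp: oracle_rule_def eval_rule_def Let_def l_def)
    show ?thesis
    proof (cases "lhd l")
      case 0
      then have "\<langle>encode f, \<langle>ltl l, y\<rangle>\<rangle> \<in> R"
        using J p [symmetric] Prim by (auto simp: oracle_rule_def eval_rule_def Let_def l_def y_def)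
      from eval_Prim0 [OF prog [OF this]] Prim l0 0 show ?thesis by (simp add: list_decode_nonzero)
    next
      case (Suc n)
      then obtain c where c: "c \<in> R" "pfst c = encode p" "pfst (psnd c) = Suc \<langle>n, ltl l\<rangle>"
        "\<langle>encode g, \<langle>Suc \<langle>psnd (psnd c), Suc \<langle>n, ltl l\<rangle>\<rangle>, y\<rangle>\<rangle> \<in> R"
        using J p [symmetric] Prim by (auto simp: oracle_rule_def eval_rule_def Let_def l_def y_def)
      have "\<langle>encode p, \<langle>Suc \<langle>n, ltl l\<rangle>, psnd (psnd c)\<rangle>\<rangle> \<in> R"
        using c(1) fact_eq [of c] unfolding c(2,3) by simp
      from prog [OF this] prog [OF c(4)] Prim l0 Suc show ?thesis
        by (simp add: list_decode_nonzero eval_PrimS)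
    qed
  next
    case (Mn f)
    then have 1: "\<langle>encode f, \<langle>Suc \<langle>y, l\<rangle>, 0\<rangle>\<rangle> \<in> R"
      and 2: "\<forall>m<y. \<exists>c\<in>R. pfst c = encode f \<and> pfst (psnd c) = Suc \<langle>m, l\<rangle> \<and> psnd (psnd c) \<noteq> 0"
      using J p [symmetric] by (auto simp: oracle_rule_def eval_rule_def Let_def l_def y_def)
    have "\<exists>k. eval A f (m # list_decode l) (Suc k)" if m: "m < y" for m
    proof -
      obtain c where c: "c \<in> R" "pfst c = encode f" "pfst (psnd c) = Suc \<langle>m, l\<rangle>" "psnd (psnd c) \<noteq> 0"
        using 2 m by blast
      then obtain k where k: "psnd (psnd c) = Suc k" using not0_implies_Suc by blast
      have "\<langle>encode f, \<langle>Suc \<langle>m, l\<rangle>, Suc k\<rangle>\<rangle> \<in> R"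
        using c(1) fact_eq [of c] unfolding c(2,3) k by simp
      from prog [OF this] show ?thesis by auto
    qed
    with prog [OF 1] Mn show ?thesis by (simp add: eval_Mn)
  next
    case Orc
    then have "l \<noteq> 0" "y = (if lhd l \<in> A then 1 else 0)"
      using J p [symmetric]
      by (auto simp: oracle_rule_def eval_rule_def Let_def is_query_def answer_def query_def l_def y_def)
    with eval_Orc [of A "lhd l" "list_decode (ltl l)"] Orc show ?thesis
      by (simp add: list_decode_nonzero)
  qed
  moreover have "list_all2 (\<lambda>p y. eval A p (list_decode l) y) ps (list_decode y)"
    if ps: "\<langle>7, list_encode (map encode ps)\<rangle> = pfst a" for ps
  proof (cases ps)
    case Nil
    then have "y = 0"
      using J ps [symmetric] by (auto simp: oracle_rule_def eval_rule_def Let_def y_def)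
    with Nil show ?thesis by simp
  next
    case (Cons p qs)
    then have "y \<noteq> 0" "\<langle>encode p, \<langle>l, lhd y\<rangle>\<rangle> \<in> R" "\<langle>\<langle>7, list_encode (map encode qs)\<rangle>, \<langle>l, ltl y\<rangle>\<rangle> \<in> R"
      using J ps [symmetric] by (auto simp: oracle_rule_def eval_rule_def Let_def l_def y_def)
    with prog list Cons show ?thesis by (simp add: list_decode_nonzero)
  qed
  ultimately show "(\<forall>p. encode p = pfst a \<longrightarrow> eval A p (list_decode (pfst (psnd a))) (psnd (psnd a))) \<and>
    (\<forall>ps. \<langle>7, list_encode (map encode ps)\<rangle> = pfst a \<longrightarrow>
      list_all2 (\<lambda>p y. eval A p (list_decode (pfst (psnd a))) y) ps (list_decode (psnd (psnd a))))"
    by (simp add: l_def y_def)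
qed

section \<open>Normal forms\<close>

text \<open>The first half of \<open>d\<close> shows that \<open>i\<close> codes a program; the
  second half is a computation on the argument list \<open>[n]\<close>, whose code is
  \<open>Suc \<langle>n, 0\<rangle>\<close>. Oracle answers remain unchecked.\<close>

definition certifies :: "nat \<Rightarrow> nat \<Rightarrow> nat \<Rightarrow> bool" where
  "certifies d i n \<longleftrightarrow>
    derivation prog_rule (list_decode (pfst d)) \<and> \<langle>0, i\<rangle> \<in> set (list_decode (pfst d)) \<and>
    derivation eval_rule (list_decode (psnd d)) \<and>
    (\<exists>a\<in>set (list_decode (psnd d)). pfst a = i \<and> pfst (psnd a) = Suc \<langle>n, 0\<rangle>)"

definition queries :: "nat \<Rightarrow> nat set" where
  "queries d = {a \<in> set (list_decode (psnd d)). is_query a}"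

lemma finite_queries [simp]: "finite (queries d)"
  by (simp add: queries_def)

text \<open>This is the use principle: a halting computation depends on the oracle only through the
  finitely many answers recorded in its certificate.\<close>

lemma mem_W_iff:
  "n \<in> W A i \<longleftrightarrow> (\<exists>d. certifies d i n \<and> (\<forall>a\<in>queries d. answer a = 1 \<longleftrightarrow> query a \<in> A))"
proof
  assume "n \<in> W A i"
  then obtain p y where p: "encode p = i" and "eval A p [n] y"
    unfolding W_def phi_def by blast
  from derivable_eval_fact [OF this(2)] obtain as
    where as: "derivation (oracle_rule A) as" "eval_fact p [n] y \<in> set as"
    unfolding derivable_def by blast
  from derivable_prog [of p] obtain bs
    where bs: "derivation prog_rule bs" "\<langle>0, i\<rangle> \<in> set bs"
    unfolding derivable_def p by blast
  have "certifies \<langle>list_encode bs, list_encode as\<rangle> i n"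
    unfolding certifies_def using as bs p
    by (auto simp: derivation_oracle_rule_iff intro!: bexI [of _ "eval_fact p [n] y"])
  moreover have "\<forall>a\<in>queries \<langle>list_encode bs, list_encode as\<rangle>. answer a = 1 \<longleftrightarrow> query a \<in> A"
    using as by (simp add: derivation_oracle_rule_iff queries_def)
  ultimately show "\<exists>d. certifies d i n \<and> (\<forall>a\<in>queries d. answer a = 1 \<longleftrightarrow> query a \<in> A)"
    by blast
next
  assume "\<exists>d. certifies d i n \<and> (\<forall>a\<in>queries d. answer a = 1 \<longleftrightarrow> query a \<in> A)"
  then obtain d where d: "certifies d i n" "\<forall>a\<in>queries d. answer a = 1 \<longleftrightarrow> query a \<in> A"
    by blast
  obtain p where p: "encode p = i"
    using d(1) prog_rule_sound [of _ "\<langle>0, i\<rangle>"] unfolding certifies_def by fastforce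
  obtain a where a: "a \<in> set (list_decode (psnd d))" "pfst a = i" "pfst (psnd a) = Suc \<langle>n, 0\<rangle>"
    using d(1) unfolding certifies_def by blast
  have "derivation (oracle_rule A) (list_decode (psnd d))"
    using d unfolding derivation_oracle_rule_iff certifies_def queries_def by blast
  from oracle_rule_sound [OF this a(1)] p a have "eval A p [n] (psnd (psnd a))" by simp
  with p show "n \<in> W A i" unfolding W_def phi_def by blast
qed

lemma decidable_certifies [computable_intros]:
  assumes "computable d" "computable i" "computable n"
  shows "decidable (\<lambda>x. certifies (d x) (i x) (n x))"
proof -
  have "decidable (\<lambda>z. certifies (pfst z) (pfst (psnd z)) (psnd (psnd z)))"
    unfolding certifies_def
    by (intro computable_intros decidable_derivation decidable_prog_rule decidable_eval_rule)
  from decidable_compose [OF this computable_pair [OF assms(1) computable_pair [OF assms(2,3)]]]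
  show ?thesis by simp
qed

lemma decidable_ball_queries [computable_intros]:
  assumes "computable d" "decidable (\<lambda>z. P (pfst z) (psnd z))"
  shows "decidable (\<lambda>x. \<forall>a\<in>queries (d x). P x a)"
proof -
  have "decidable (\<lambda>x. \<forall>a\<in>set (list_decode (psnd (d x))). is_query a \<longrightarrow> P x a)"
    unfolding is_query_def by (intro computable_intros assms)
  then show ?thesis by (simp add: queries_def Ball_def imp_conjL)
qed

lemma computable_query [computable_intros]: "computable f \<Longrightarrow> computable (\<lambda>x. query (f x))"
  unfolding query_def by (intro computable_intros)

lemma computable_answer [computable_intros]: "computable f \<Longrightarrow> computable (\<lambda>x. answer (f x))"
  unfolding answer_def by (intro computable_intros)

text \<open>For the empty oracle the answers can be checked outright, so this is a decidable
  analogue of Kleene's T predicate.\<close>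

definition halts :: "nat \<Rightarrow> nat \<Rightarrow> nat \<Rightarrow> bool" where
  "halts i n d \<longleftrightarrow> certifies d i n \<and> (\<forall>a\<in>queries d. answer a \<noteq> 1)"

lemma mem_W_empty_iff: "n \<in> W {} i \<longleftrightarrow> (\<exists>d. halts i n d)"
  by (simp add: mem_W_iff halts_def)

lemma decidable_halts [computable_intros]:
  assumes "computable i" "computable n" "computable d"
  shows "decidable (\<lambda>x. halts (i x) (n x) (d x))"
proof -
  have "decidable (\<lambda>z. halts (pfst z) (pfst (psnd z)) (psnd (psnd z)))"
    unfolding halts_def by (intro computable_intros)
  from decidable_compose [OF this computable_pair [OF assms(1) computable_pair [OF assms(2,3)]]]
  show ?thesis by simp
qed

text \<open>Collection: the maximum of finitely many chosen witnesses bounds them all.\<close>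

lemma bounded_witnesses:
  assumes "finite L" "\<forall>a\<in>L. \<exists>e. H a e"
  shows "\<exists>w::nat. \<forall>a\<in>L. \<exists>e\<le>w. H a e"
proof -
  obtain f where f: "\<forall>a\<in>L. H a (f a)" using bchoice [OF assms(2)] by blast
  show ?thesis
  proof (rule exI [of _ "Max (f ` L)"], rule ballI)
    fix a assume "a \<in> L"
    with f assms(1) show "\<exists>e\<le>Max (f ` L). H a e" by (intro exI [of _ "f a"]) simp
  qed
qed

text \<open>If each of the finitely many \<open>k\<close> failed at some stage, a common bound of
  these stages would contradict the assumption.\<close>

lemma ex_bounded_all:
  fixes w :: nat and Q :: "nat \<Rightarrow> nat \<Rightarrow> bool"
  assumes "\<And>u. \<exists>k\<le>w. \<forall>s\<le>u. Q k s"
  shows "\<exists>k\<le>w. \<forall>s. Q k s"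
proof (rule ccontr)
  assume "\<not> ?thesis"
  then have "\<forall>k\<in>{..w}. \<exists>s. \<not> Q k s" by auto
  from bounded_witnesses [OF finite_atMost this] obtain u where u: "\<forall>k\<in>{..w}. \<exists>s\<le>u. \<not> Q k s" ..
  obtain k where "k \<le> w" "\<forall>s\<le>u. Q k s" using assms by blast
  with u show False by blast
qed

text \<open>Here \<open>k\<close> pairs a certificate with a bound on the halting certificates
  behind its positive answers, while \<open>s\<close> runs through the potential halting
  certificates that would refute a negative answer.\<close>

definition zero2_matrix :: "nat \<Rightarrow> nat \<Rightarrow> nat \<Rightarrow> bool" where
  "zero2_matrix x k s \<longleftrightarrow> certifies (pfst k) x x \<and>
    (\<forall>a\<in>queries (pfst k). (answer a = 1 \<longrightarrow> (\<exists>e\<le>psnd k. halts (query a) (query a) e)) \<and>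
      (answer a \<noteq> 1 \<longrightarrow> \<not> halts (query a) (query a) s))"

lemma mem_zero2_iff: "x \<in> zero2 \<longleftrightarrow> (\<exists>k. \<forall>s. zero2_matrix x k s)"
proof -
  have jump: "z \<in> jump {} \<longleftrightarrow> (\<exists>e. halts z z e)" for z
    by (simp add: jump_def mem_W_empty_iff)
  have "x \<in> zero2 \<longleftrightarrow> (\<exists>d. certifies d x x \<and>
      (\<forall>a\<in>queries d. answer a = 1 \<longleftrightarrow> (\<exists>e. halts (query a) (query a) e)))"
    unfolding zero2_def jump_def [of "jump {}"] mem_Collect_eq mem_W_iff jump ..
  also have "\<dots> \<longleftrightarrow> (\<exists>k. \<forall>s. zero2_matrix x k s)"
  proof
    assume "\<exists>d. certifies d x x \<and>
      (\<forall>a\<in>queries d. answer a = 1 \<longleftrightarrow> (\<exists>e. halts (query a) (query a) e))"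
    then obtain d where d: "certifies d x x"
      "\<forall>a\<in>queries d. answer a = 1 \<longleftrightarrow> (\<exists>e. halts (query a) (query a) e)" by blast
    then have "\<forall>a\<in>queries d. \<exists>e. answer a = 1 \<longrightarrow> halts (query a) (query a) e" by blast
    from bounded_witnesses [OF _ this] obtain w
      where "\<forall>a\<in>queries d. \<exists>e\<le>w. answer a = 1 \<longrightarrow> halts (query a) (query a) e" by auto
    with d have "\<forall>s. zero2_matrix x \<langle>d, w\<rangle> s"
      unfolding zero2_matrix_def pfst_pair psnd_pair by blast
    then show "\<exists>k. \<forall>s. zero2_matrix x k s" ..
  next
    assume "\<exists>k. \<forall>s. zero2_matrix x k s"
    then obtain k where "\<forall>s. zero2_matrix x k s" ..
    then have "certifies (pfst k) x x \<and>
      (\<forall>a\<in>queries (pfst k). answer a = 1 \<longleftrightarrow> (\<exists>e. halts (query a) (query a) e))"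
      unfolding zero2_matrix_def by blast
    then show "\<exists>d. certifies d x x \<and>
      (\<forall>a\<in>queries d. answer a = 1 \<longleftrightarrow> (\<exists>e. halts (query a) (query a) e))" ..
  qed
  finally show ?thesis .
qed

lemma decidable_zero2_matrix [computable_intros]:
  assumes "computable x" "computable k" "computable s"
  shows "decidable (\<lambda>z. zero2_matrix (x z) (k z) (s z))"
proof -
  have "decidable (\<lambda>z. zero2_matrix (pfst z) (pfst (psnd z)) (psnd (psnd z)))"
    unfolding zero2_matrix_def by (intro computable_intros)
  from decidable_compose [OF this computable_pair [OF assms(1) computable_pair [OF assms(2,3)]]]
  show ?thesis by simp
qed

text \<open>Again \<open>k\<close> pairs a certificate with a bound, now for witnesses of the
  \<Sigma>\<open>\<^sub>2\<close> conditions behind positive answers. The number \<open>u\<close>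
  limits the stages at which these witnesses are tested and also the candidates to be refuted for
  negative answers; \<open>v\<close> bounds the refutations.\<close>

definition sigma3_matrix :: "nat \<Rightarrow> nat \<Rightarrow> nat \<Rightarrow> nat \<Rightarrow> nat \<Rightarrow> bool" where
  "sigma3_matrix i n k u v \<longleftrightarrow> certifies (pfst k) i n \<and>
    (\<forall>a\<in>queries (pfst k).
      (answer a = 1 \<longrightarrow> (\<exists>l\<le>psnd k. \<forall>s\<le>u. zero2_matrix (query a) l s)) \<and>
      (answer a \<noteq> 1 \<longrightarrow> (\<forall>l\<le>u. \<exists>s\<le>v. \<not> zero2_matrix (query a) l s)))"

lemma mem_W_zero2_iff: "n \<in> W zero2 i \<longleftrightarrow> (\<exists>k. \<forall>u. \<exists>v. sigma3_matrix i n k u v)"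
proof
  assume "n \<in> W zero2 i"
  then obtain d where d: "certifies d i n"
    "\<forall>a\<in>queries d. answer a = 1 \<longleftrightarrow> (\<exists>l. \<forall>s. zero2_matrix (query a) l s)"
    unfolding mem_W_iff mem_zero2_iff by blast
  then have "\<forall>a\<in>queries d. \<exists>l. answer a = 1 \<longrightarrow> (\<forall>s. zero2_matrix (query a) l s)" by blast
  from bounded_witnesses [OF _ this] obtain w
    where w: "\<forall>a\<in>queries d. \<exists>l\<le>w. answer a = 1 \<longrightarrow> (\<forall>s. zero2_matrix (query a) l s)" by auto
  have "\<exists>v. sigma3_matrix i n \<langle>d, w\<rangle> u v" for u
  proof -
    \<comment> \<open>Collecting over pairs of a query and a candidate \<open>l \<le> u\<close>
      gives one \<open>v\<close> for all of them.\<close>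
    have "\<forall>b\<in>queries d \<times> {..u}. \<exists>s. answer (fst b) \<noteq> 1 \<longrightarrow> \<not> zero2_matrix (query (fst b)) (snd b) s"
      using d by auto
    from bounded_witnesses [OF _ this] obtain v
      where v: "\<forall>b\<in>queries d \<times> {..u}. \<exists>s\<le>v. answer (fst b) \<noteq> 1 \<longrightarrow> \<not> zero2_matrix (query (fst b)) (snd b) s"
      by auto
    have "\<exists>s\<le>v. \<not> zero2_matrix (query a) l s" if "a \<in> queries d" "answer a \<noteq> 1" "l \<le> u" for a l
      using bspec [OF v, of "(a, l)"] that by auto
    with d(1) w show ?thesis
      unfolding sigma3_matrix_def pfst_pair psnd_pair by blast
  qed
  then show "\<exists>k. \<forall>u. \<exists>v. sigma3_matrix i n k u v" by blast
next
  assume "\<exists>k. \<forall>u. \<exists>v. sigma3_matrix i n k u v"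
  then obtain k where k: "\<And>u. \<exists>v. sigma3_matrix i n k u v" by blast
  have "answer a = 1 \<longleftrightarrow> query a \<in> zero2" if a: "a \<in> queries (pfst k)" for a
  proof (cases "answer a = 1")
    case True
    then have "\<exists>l\<le>psnd k. \<forall>s\<le>u. zero2_matrix (query a) l s" for u
      using k [of u] a unfolding sigma3_matrix_def by blast
    \<comment> \<open>So far \<open>l\<close> may vary with \<open>u\<close>; boundedness yields one
      \<open>l\<close> that survives all stages.\<close>
    then have "\<exists>l\<le>psnd k. \<forall>s. zero2_matrix (query a) l s"
      by (rule ex_bounded_all)
    with True show ?thesis unfolding mem_zero2_iff by blast
  next
    case False
    then have "\<exists>s. \<not> zero2_matrix (query a) l s" for l
      using k [of l] a unfolding sigma3_matrix_def by blast
    with False show ?thesis unfolding mem_zero2_iff by blast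
  qed
  moreover have "certifies (pfst k) i n" using k unfolding sigma3_matrix_def by blast
  ultimately show "n \<in> W zero2 i" unfolding mem_W_iff by blast
qed

lemma decidable_sigma3_matrix [computable_intros]:
  assumes "computable i" "computable n" "computable k" "computable u" "computable v"
  shows "decidable (\<lambda>z. sigma3_matrix (i z) (n z) (k z) (u z) (v z))"
proof -
  have "decidable (\<lambda>z. sigma3_matrix (pfst z) (pfst (psnd z)) (pfst (psnd (psnd z)))
      (pfst (psnd (psnd (psnd z)))) (psnd (psnd (psnd (psnd z)))))"
    unfolding sigma3_matrix_def by (intro computable_intros)
  from decidable_compose [OF this computable_pair [OF assms(1) computable_pair [OF assms(2)
        computable_pair [OF assms(3) computable_pair [OF assms(4,5)]]]]]
  show ?thesis by simp
qed

subsection \<open>Infinitely many firings\<close>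

text \<open>Asking for all \<open>u' \<le> u\<close> ensures that a single \<open>u\<close> without
  a witness rules out firing for every later one.\<close>

definition bounds_upto :: "nat \<Rightarrow> nat \<Rightarrow> nat \<Rightarrow> nat \<Rightarrow> nat \<Rightarrow> bool" where
  "bounds_upto i n k u w \<longleftrightarrow> (\<forall>u'\<le>u. \<exists>v\<le>w. sigma3_matrix i n k u' v)"

text \<open>Minimality of \<open>psnd s\<close> makes each \<open>u\<close> account for at most one firing.\<close>

definition fires :: "nat \<Rightarrow> nat \<Rightarrow> nat \<Rightarrow> nat \<Rightarrow> bool" where
  "fires i n k s \<longleftrightarrow> bounds_upto i n k (pfst s) (psnd s) \<and>
    (\<forall>w<psnd s. \<not> bounds_upto i n k (pfst s) w)"

lemma decidable_fires [computable_intros]: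
  assumes "computable i" "computable n" "computable k" "computable s"
  shows "decidable (\<lambda>z. fires (i z) (n z) (k z) (s z))"
proof -
  have "decidable (\<lambda>z. fires (pfst z) (pfst (psnd z)) (pfst (psnd (psnd z))) (psnd (psnd (psnd z))))"
    unfolding fires_def bounds_upto_def by (intro computable_intros)
  from decidable_compose [OF this computable_pair [OF assms(1) computable_pair [OF assms(2)
        computable_pair [OF assms(3,4)]]]]
  show ?thesis by simp
qed

text \<open>If every \<open>u\<close> has a witness, each contributes a firing at its least bound.
  If some \<open>u\<close> has none, only smaller first components can fire, at most once
  each.\<close>

lemma infinite_fires_iff: "infinite {s. fires i n k s} \<longleftrightarrow> (\<forall>u. \<exists>v. sigma3_matrix i n k u v)"
proof -
  \<comment> \<open>The only stage with first component \<open>u\<close> that can fire; without a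
    bound its second component is arbitrary.\<close>
  define least where "least u = \<langle>u, LEAST w. bounds_upto i n k u w\<rangle>" for u
  have inj: "inj least" unfolding least_def by (auto intro: injI simp: prod_encode_eq)
  have least: "least u = s" if "fires i n k s" "pfst s = u" for s u
  proof -
    have "(LEAST w. bounds_upto i n k u w) = psnd s"
      using that unfolding fires_def by (intro Least_equality) (auto simp: not_less [symmetric])
    with that show ?thesis unfolding least_def by auto
  qed
  show ?thesis
  proof
    assume all: "\<forall>u. \<exists>v. sigma3_matrix i n k u v"
    have "fires i n k (least u)" for u
    proof -
      have "\<forall>u'\<in>{..u}. \<exists>v. sigma3_matrix i n k u' v" using all by blast
      from bounded_witnesses [OF finite_atMost this] have "\<exists>w. bounds_upto i n k u w"
        unfolding bounds_upto_def by auto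
      then show ?thesis
        unfolding fires_def least_def pfst_pair psnd_pair by (auto intro: LeastI_ex dest: not_less_Least)
    qed
    then have "range least \<subseteq> {s. fires i n k s}" by blast
    then show "infinite {s. fires i n k s}"
      using finite_subset finite_imageD [OF _ inj] infinite_UNIV_nat by blast
  next
    assume inf: "infinite {s. fires i n k s}"
    show "\<forall>u. \<exists>v. sigma3_matrix i n k u v"
    proof (rule ccontr)
      assume "\<not> ?thesis"
      then obtain u where u: "\<And>v. \<not> sigma3_matrix i n k u v" by blast
      have "{s. fires i n k s} \<subseteq> least ` {..<u}"
      proof
        fix s assume "s \<in> {s. fires i n k s}"
        then have s: "fires i n k s" by simp
        then have "pfst s < u"
          using u unfolding fires_def bounds_upto_def by (meson not_le)
        with least [OF s refl] show "s \<in> least ` {..<u}" by force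
      qed
      with inf show False using finite_surj by blast
    qed
  qed
qed

lemma mem_W_zero2_iff_fires: "n \<in> W zero2 i \<longleftrightarrow> (\<exists>k. infinite {s. fires i n k s})"
  by (simp add: mem_W_zero2_iff infinite_fires_iff)

section \<open>The reductions\<close>

lemma c_reducible_trans: "c_reducible E F \<Longrightarrow> c_reducible F G \<Longrightarrow> c_reducible E G"
proof -
  assume "c_reducible E F" "c_reducible F G"
  then obtain f g where f: "computable_total f" "\<And>x y. E x y \<longleftrightarrow> F (f x) (f y)"
    and g: "computable_total g" "\<And>x y. F x y \<longleftrightarrow> G (g x) (g y)"
    unfolding c_reducible_def by blast
  have "computable_total (\<lambda>x. g (f x))"
    using f(1) g(1) unfolding computable_total_def by (meson eval_Comp1)
  with f(2) g(2) show "c_reducible E G" unfolding c_reducible_def by blast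
qed

lemma cofinite_iff: "cofinite X \<longleftrightarrow> (\<exists>k. \<forall>u. k \<le> u \<longrightarrow> u \<in> X)"
  unfolding cofinite_def finite_nat_set_iff_bounded by (auto simp: not_less [symmetric])

text \<open>Cofiniteness of a c.e. column is \<Sigma>\<open>\<^sub>3\<close>: beyond some
  \<open>k\<close>, every \<open>u\<close> has a halting certificate. Hence the indices of cofinite
  columns form a set c.e. in \<open>zero2\<close>, uniformly.\<close>

lemma E_Cof_le_E2_eq: "c_reducible E_Cof E2_eq"
proof -
  define P where "P z = (let v = psnd z; u = psnd (pfst z); k = psnd (pfst (pfst z));
    n = psnd (pfst (pfst (pfst z))); i = pfst (pfst (pfst (pfst z))) in
    k \<le> u \<longrightarrow> halts i \<langle>u, n\<rangle> v)" for z
  have "decidable P" unfolding P_def Let_def by (intro computable_intros)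
  from W_zero2_index_ex_all_ex [OF this] obtain g where g: "computable g"
    "\<And>i. W zero2 (g i) = {n. \<exists>k. \<forall>u. \<exists>v. k \<le> u \<longrightarrow> halts i \<langle>u, n\<rangle> v}"
    by (auto simp: P_def)
  have "W zero2 (g i) = {n. cofinite (column (W {} i) n)}" for i
    unfolding g cofinite_iff column_def mem_W_empty_iff mem_Collect_eq by blast
  then have "E_Cof i j \<longleftrightarrow> E2_eq (g i) (g j)" for i j
    unfolding E_Cof_def E2_eq_def by auto
  with computable_imp_computable_total [OF g(1)] show ?thesis
    unfolding c_reducible_def by blast
qed

text \<open>A family of columns is therefore determined by the set of c.e. indices of its
  members.\<close>

lemma column_W_is_W: "\<exists>e. W {} e = column (W {} i) k"
proof -
  have "decidable (\<lambda>z. halts i \<langle>psnd (pfst z), k\<rangle> (psnd z))" by (intro computable_intros)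
  from W_index_ex [OF this, of "{}"] show ?thesis
    by (auto simp: column_def mem_W_empty_iff)
qed

text \<open>Equality of two c.e. sets is \<Pi>\<open>\<^sub>2\<close>, so being an index of some
  column is \<Sigma>\<open>\<^sub>3\<close>. The reduction sends \<open>i\<close> to an index of
  this set of indices.\<close>

lemma E_set_le_E2_eq: "c_reducible E_set E2_eq"
proof -
  \<comment> \<open>The universal variable is a pair of an element and a possible certificate for
    either set; \<open>v\<close> pairs the certificates that answer in the two directions.\<close>
  define P where "P z = (let v = psnd z; x = pfst (psnd (pfst z)); c = psnd (psnd (pfst z));
    k = psnd (pfst (pfst z)); e = psnd (pfst (pfst (pfst z))); i = pfst (pfst (pfst (pfst z))) in
    (halts e x c \<longrightarrow> halts i \<langle>x, k\<rangle> (pfst v)) \<and> (halts i \<langle>x, k\<rangle> c \<longrightarrow> halts e x (psnd v)))" for z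
  have "decidable P" unfolding P_def Let_def by (intro computable_intros)
  from W_zero2_index_ex_all_ex [OF this] obtain g where g: "computable g"
    "\<And>i. W zero2 (g i) = {e. \<exists>k. \<forall>u. \<exists>v. P \<langle>\<langle>\<langle>\<langle>i, e\<rangle>, k\<rangle>, u\<rangle>, v\<rangle>}"
    by blast
  have eq: "(\<forall>u. \<exists>v. P \<langle>\<langle>\<langle>\<langle>i, e\<rangle>, k\<rangle>, u\<rangle>, v\<rangle>) \<longleftrightarrow> W {} e = column (W {} i) k" for i e k
  proof
    assume L: "\<forall>u. \<exists>v. P \<langle>\<langle>\<langle>\<langle>i, e\<rangle>, k\<rangle>, u\<rangle>, v\<rangle>"
    have "(halts e x c \<longrightarrow> (\<exists>v. halts i \<langle>x, k\<rangle> v)) \<and> (halts i \<langle>x, k\<rangle> c \<longrightarrow> (\<exists>v. halts e x v))" for x c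
      using spec [OF L, of "\<langle>x, c\<rangle>"] by (auto simp: P_def)
    then show "W {} e = column (W {} i) k"
      unfolding column_def set_eq_iff mem_W_empty_iff mem_Collect_eq by blast
  next
    assume R: "W {} e = column (W {} i) k"
    show "\<forall>u. \<exists>v. P \<langle>\<langle>\<langle>\<langle>i, e\<rangle>, k\<rangle>, u\<rangle>, v\<rangle>"
    proof
      fix u
      have "\<exists>v. halts e (pfst u) (psnd u) \<longrightarrow> halts i \<langle>pfst u, k\<rangle> v"
        "\<exists>v. halts i \<langle>pfst u, k\<rangle> (psnd u) \<longrightarrow> halts e (pfst u) v"
        using R unfolding column_def set_eq_iff mem_W_empty_iff mem_Collect_eq by blast+
      then obtain v v' where "halts e (pfst u) (psnd u) \<longrightarrow> halts i \<langle>pfst u, k\<rangle> v"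
        "halts i \<langle>pfst u, k\<rangle> (psnd u) \<longrightarrow> halts e (pfst u) v'" by blast
      then have "P \<langle>\<langle>\<langle>\<langle>i, e\<rangle>, k\<rangle>, u\<rangle>, \<langle>v, v'\<rangle>\<rangle>" by (simp add: P_def)
      then show "\<exists>v. P \<langle>\<langle>\<langle>\<langle>i, e\<rangle>, k\<rangle>, u\<rangle>, v\<rangle>" ..
    qed
  qed
  have W_g: "W zero2 (g i) = {e. W {} e \<in> {column (W {} i) k | k. True}}" for i
    unfolding g eq by blast
  have "E_set i j \<longleftrightarrow> E2_eq (g i) (g j)" for i j
  proof
    assume "E2_eq (g i) (g j)"
    then have *: "W {} e \<in> {column (W {} i) k | k. True} \<longleftrightarrow> W {} e \<in> {column (W {} j) k | k. True}" for e
      unfolding E2_eq_def W_g by blast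
    show "E_set i j"
      unfolding E_set_def
    proof (intro subset_antisym subsetI)
      fix X assume X: "X \<in> {column (W {} i) k | k. True}"
      then obtain e where "W {} e = X" using column_W_is_W by blast
      with X * [of e] show "X \<in> {column (W {} j) k | k. True}" by simp
    next
      fix X assume X: "X \<in> {column (W {} j) k | k. True}"
      then obtain e where "W {} e = X" using column_W_is_W by blast
      with X * [of e] show "X \<in> {column (W {} i) k | k. True}" by simp
    qed
  qed (simp add: E_set_def E2_eq_def W_g)
  with computable_imp_computable_total [OF g(1)] show ?thesis
    unfolding c_reducible_def by blast
qed

text \<open>Column \<open>\<langle>n, \<langle>b, k\<rangle>\<rangle>\<close> lives in \<open>{\<langle>n, x\<rangle> | x. True}\<close>. For \<open>b = 0\<close> it is the initial segment of
  length \<open>k\<close>; otherwise it grows with every firing of \<open>k\<close>, so it is another finite initial segment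
  unless \<open>k\<close> witnesses that \<open>n\<close> belongs to the coded set.\<close>

lemma E2_eq_le_E_set: "c_reducible E2_eq E_set"
proof -
  define P where "P z = (let s = psnd z; y = pfst (psnd (pfst z)); m = psnd (psnd (pfst z));
    i = pfst (pfst z); n = pfst m; b = pfst (psnd m); k = psnd (psnd m) in
    pfst y = n \<and> (b = 0 \<and> psnd y < k \<or> b \<noteq> 0 \<and> psnd y \<le> s \<and> fires i n k s))" for z
  have "decidable P" unfolding P_def Let_def by (intro computable_intros)
  from W_index_ex [OF this, of "{}"] obtain g where g: "computable g"
    "\<And>i. W {} (g i) = {x. \<exists>s. P \<langle>\<langle>i, x\<rangle>, s\<rangle>}"
    by blast
  define seg where "seg n X = pair_code n ` X" for n X
  have mem_seg: "y \<in> seg n X \<longleftrightarrow> pfst y = n \<and> psnd y \<in> X" for y n X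
    unfolding seg_def by (metis (no_types, lifting) image_iff pair_pfst_psnd pfst_pair psnd_pair)
  \<comment> \<open>The empty segment is the same for all \<open>n\<close>; any other determines
    both its \<open>n\<close> and its contents.\<close>
  have seg_eq: "n = n' \<and> X = X'" if eq: "seg n X = seg n' X'" and "X \<noteq> {}" for n n' X X'
  proof -
    have iff: "m = n \<and> x \<in> X \<longleftrightarrow> m = n' \<and> x \<in> X'" for m x
      using mem_seg [of "\<langle>m, x\<rangle>" n X] mem_seg [of "\<langle>m, x\<rangle>" n' X'] unfolding eq by simp
    obtain x where "x \<in> X" using \<open>X \<noteq> {}\<close> by blast
    with iff [of n x] have "n = n'" by simp
    with iff show ?thesis by blast
  qed
  have col0: "column (W {} (g i)) \<langle>n, \<langle>0, k\<rangle>\<rangle> = seg n {..<k}" for i n k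
    by (auto simp: column_def g P_def mem_seg)
  have col1: "column (W {} (g i)) \<langle>n, \<langle>b, k\<rangle>\<rangle> = seg n {x. \<exists>s\<ge>x. fires i n k s}" if "b \<noteq> 0" for i n k b
    using that by (auto simp: column_def g P_def mem_seg)
  have initial: "{x. \<exists>s\<ge>x. fires i n k s} = UNIV" if "infinite {s. fires i n k s}" for i n k
    using that unfolding finite_nat_set_iff_bounded by (auto simp: not_less)
  have initial': "\<exists>l. {x. \<exists>s\<ge>x. fires i n k s} = {..<l}" if "finite {s. fires i n k s}" for i n k
  proof (cases "{s. fires i n k s} = {}")
    case True
    then have "{x. \<exists>s\<ge>x. fires i n k s} = {..<0}" by auto
    then show ?thesis ..
  next
    case False
    define m where "m = Max {s. fires i n k s}"
    have "fires i n k m" "\<And>s. fires i n k s \<Longrightarrow> s \<le> m"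
      using Max_in [OF that False] Max_ge [OF that] by (simp_all add: m_def)
    then have "{x. \<exists>s\<ge>x. fires i n k s} = {..<Suc m}"
      unfolding set_eq_iff lessThan_iff less_Suc_eq_le mem_Collect_eq using le_trans by blast
    then show ?thesis ..
  qed
  \<comment> \<open>The columns with \<open>b = 0\<close> already supply every finite segment, so a
    \<open>k\<close> that fires finitely often adds nothing and only the full segments depend on
    \<open>i\<close>.\<close>
  have family: "{column (W {} (g i)) m | m. True} =
      {seg n {..<k} | n k. True} \<union> {seg n UNIV | n. n \<in> W zero2 i}" for i
  proof (intro subset_antisym subsetI)
    fix X assume "X \<in> {column (W {} (g i)) m | m. True}"
    then obtain m where m: "X = column (W {} (g i)) m" by blast
    obtain n b k where nbk: "m = \<langle>n, \<langle>b, k\<rangle>\<rangle>" by (metis pair_pfst_psnd)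
    show "X \<in> {seg n {..<k} | n k. True} \<union> {seg n UNIV | n. n \<in> W zero2 i}"
    proof (cases "b = 0")
      case True
      then show ?thesis using col0 m nbk by blast
    next
      case b: False
      show ?thesis
      proof (cases "finite {s. fires i n k s}")
        case True
        then obtain l where "{x. \<exists>s\<ge>x. fires i n k s} = {..<l}" using initial' by blast
        with m nbk col1 [OF b] have "X = seg n {..<l}" by simp
        then show ?thesis by blast
      next
        case False
        then have "n \<in> W zero2 i" unfolding mem_W_zero2_iff_fires by blast
        moreover have "X = seg n UNIV" using m nbk col1 [OF b] initial [OF False] by simp
        ultimately show ?thesis by blast
      qed
    qed
  next
    fix X assume "X \<in> {seg n {..<k} | n k. True} \<union> {seg n UNIV | n. n \<in> W zero2 i}"
    then consider n k where "X = seg n {..<k}" | n where "X = seg n UNIV" "n \<in> W zero2 i" by blast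
    then show "X \<in> {column (W {} (g i)) m | m. True}"
    proof cases
      case 1
      then show ?thesis using col0 by blast
    next
      case 2
      then obtain k where "infinite {s. fires i n k s}" unfolding mem_W_zero2_iff_fires by blast
      from initial [OF this] 2(1) have "X = column (W {} (g i)) \<langle>n, \<langle>1, k\<rangle>\<rangle>" by (simp add: col1)
      then show ?thesis by blast
    qed
  qed
  have mem: "n \<in> W zero2 i \<longleftrightarrow> seg n UNIV \<in> {column (W {} (g i)) m | m. True}" for n i
  proof
    assume "seg n UNIV \<in> {column (W {} (g i)) m | m. True}"
    then consider n' k where "seg n UNIV = seg n' {..<k}" | n' where "seg n UNIV = seg n' UNIV" "n' \<in> W zero2 i"
      unfolding family by blast
    then show "n \<in> W zero2 i"
    proof cases
      case 1
      with seg_eq [OF 1] have "(UNIV :: nat set) = {..<k}" by blast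
      then have "finite (UNIV :: nat set)" by (metis finite_lessThan)
      then show ?thesis by simp
    next
      case 2
      with seg_eq [OF 2(1)] show ?thesis by blast
    qed
  next
    assume "n \<in> W zero2 i"
    then show "seg n UNIV \<in> {column (W {} (g i)) m | m. True}" unfolding family by blast
  qed
  have "E2_eq i j \<longleftrightarrow> E_set (g i) (g j)" for i j
  proof
    assume "E2_eq i j"
    then show "E_set (g i) (g j)" unfolding E_set_def E2_eq_def family by simp
  next
    assume "E_set (g i) (g j)"
    then show "E2_eq i j" unfolding E_set_def E2_eq_def set_eq_iff [of "W zero2 i"] mem by simp
  qed
  with computable_imp_computable_total [OF g(1)] show ?thesis
    unfolding c_reducible_def by blast
qed

text \<open>\<open>\<langle>k, s\<rangle>\<close> is left out of column \<open>n\<close> iff \<open>s\<close> is the last stage (\<open>0\<close> if there is none) at which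
  some \<open>k' \<le> k\<close> fires. So \<open>k\<close> contributes exactly one element to the complement if all
  \<open>k' \<le> k\<close> fire finitely often, and none otherwise.\<close>

lemma E2_eq_le_E_Cof: "c_reducible E2_eq E_Cof"
proof -
  \<comment> \<open>A pair is enumerated once a later firing is found, or if its stage is neither a
    firing nor the default 0.\<close>
  define P where "P z = (let t = psnd z; y = pfst (psnd (pfst z)); n = psnd (psnd (pfst z));
    i = pfst (pfst z); k = pfst y; s = psnd y in
    s < t \<and> (\<exists>k'\<le>k. fires i n k' t) \<or> s \<noteq> 0 \<and> \<not> (\<exists>k'\<le>k. fires i n k' s))" for z
  have "decidable P" unfolding P_def Let_def by (intro computable_intros)
  from W_index_ex [OF this, of "{}"] obtain g where g: "computable g"
    "\<And>i. W {} (g i) = {x. \<exists>s. P \<langle>\<langle>i, x\<rangle>, s\<rangle>}"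
    by blast
  have "cofinite (column (W {} (g i)) n) \<longleftrightarrow> n \<in> W zero2 i" for i n
  proof -
    \<comment> \<open>The added 0 is the default stage: it keeps \<open>F k\<close> nonempty, so a
      maximum exists whenever \<open>F k\<close> is finite.\<close>
    define F where "F k = insert 0 {s. \<exists>k'\<le>k. fires i n k' s}" for k
    have F_mono: "F k \<subseteq> F l" if "k \<le> l" for k l
      using that unfolding F_def by (auto intro: le_trans)
    have F_infinite: "(\<exists>k. infinite (F k)) \<longleftrightarrow> n \<in> W zero2 i"
    proof -
      have "{s. \<exists>k'\<le>k. fires i n k' s} = (\<Union>k'\<in>{..k}. {s. fires i n k' s})" for k by auto
      then show ?thesis unfolding mem_W_zero2_iff_fires F_def by auto
    qed
    have "y \<in> column (W {} (g i)) n \<longleftrightarrow> \<not> (psnd y \<in> F (pfst y) \<and> (\<forall>t\<in>F (pfst y). t \<le> psnd y))" for y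
      by (auto simp: column_def g P_def Let_def F_def not_le)
    then have compl: "UNIV - column (W {} (g i)) n =
        {y. psnd y \<in> F (pfst y) \<and> (\<forall>t\<in>F (pfst y). t \<le> psnd y)}" by auto
    have last: "psnd y = Max (F (pfst y))"
      if "psnd y \<in> F (pfst y)" "\<forall>t\<in>F (pfst y). t \<le> psnd y" for y
      using that by (metis Max_eqI finite_nat_set_iff_bounded_le)
    show ?thesis
    proof (cases "n \<in> W zero2 i")
      case True
      then obtain k where k: "infinite (F k)" using F_infinite by blast
      \<comment> \<open>From \<open>k\<close> on all these sets are infinite and have no last
        element; each smaller index contributes at most one.\<close>
      have "UNIV - column (W {} (g i)) n \<subseteq> (\<lambda>k. \<langle>k, Max (F k)\<rangle>) ` {..<k}"
      proof
        fix y assume y: "y \<in> UNIV - column (W {} (g i)) n"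
        then have "finite (F (pfst y))"
          unfolding compl finite_nat_set_iff_bounded_le by blast
        then have "pfst y < k"
          using k F_mono [of k "pfst y"] finite_subset not_le by blast
        moreover have "y = \<langle>pfst y, Max (F (pfst y))\<rangle>"
          using last [of y] y unfolding compl by (metis (mono_tags, lifting) mem_Collect_eq pair_pfst_psnd)
        ultimately show "y \<in> (\<lambda>k. \<langle>k, Max (F k)\<rangle>) ` {..<k}" by blast
      qed
      with True show ?thesis unfolding cofinite_def using finite_surj by blast
    next
      case False
      then have fin: "finite (F k)" for k using F_infinite by blast
      have "F k \<noteq> {}" for k unfolding F_def by blast
      then have "range (\<lambda>k. \<langle>k, Max (F k)\<rangle>) \<subseteq> UNIV - column (W {} (g i)) n"
        unfolding compl using fin by auto
      moreover have "inj (\<lambda>k. \<langle>k, Max (F k)\<rangle>)"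
        by (auto intro: injI simp: prod_encode_eq)
      then have "infinite (range (\<lambda>k. \<langle>k, Max (F k)\<rangle>))"
        using finite_imageD infinite_UNIV_nat by blast
      ultimately have "\<not> cofinite (column (W {} (g i)) n)"
        unfolding cofinite_def using finite_subset by blast
      with False show ?thesis by blast
    qed
  qed
  then have "E2_eq i j \<longleftrightarrow> E_Cof (g i) (g j)" for i j
    unfolding E2_eq_def E_Cof_def by blast
  with computable_imp_computable_total [OF g(1)] show ?thesis
    unfolding c_reducible_def by blast
qed

theorem theorem2p4:
  shows "c_bireducible E_Cof E_set \<and> c_bireducible E_set E2_eq \<and> c_bireducible E_Cof E2_eq"
  \<comment> \<open>The reductions between \<open>E_Cof\<close> and \<open>E_set\<close> are
    composed through \<open>E2_eq\<close>.\<close>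
  unfolding c_bireducible_def
  using E_Cof_le_E2_eq E_set_le_E2_eq E2_eq_le_E_set E2_eq_le_E_Cof c_reducible_trans by blast

end
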